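(* Assume $W_c$ satisfies Assumption 1, that $H^{W_s}(M)>0$, $C:=R-H^{W_c}(X|Z)>0$, and $\frac{C}{H^{W_s}(M)}V^{W_s}(M)+V^{W_c}(X|Z)>0$. For $t\in(0,\frac12)$ and $\delta>0$ let $k_n:=\big\lfloor \frac{nC}{H^{W_s}(M)}-\delta n^{1-t}\big\rfloor$. Then \[ \lim_{n\to\infty}-\frac1{n^{1-2t}}\log P_j(k_n,n)=\frac12\cdot\frac{\delta^2}{\frac1{(H^{W_s}(M))^2}\Big[\frac{C}{H^{W_s}(M)}V^{W_s}(M)+V^{W_c}(X|Z)\Big]}. \]
   Context: Setup. $\mathcal M$ finite, $W_s$ an irreducible aperiodic transition matrix on $\mathcal M$; message $M^k$ with law $P_{M_1}(m_1)\prod_{i=2}^kW_s(m_i|m_{i-1})$. $\mathcal X$ a finite abelian group, $\mathcal Z$ finite, $W_c=\{W_c(x,z|x',z')\}$ an irreducible aperiodic transition matrix on $\mathcal X\times\mathcal Z$; noise $(X^n,Z^n)$ with law $P_{X_1Z_1}(x_1,z_1)\prod_{i=2}^nW_c(x_i,z_i|x_{i-1},z_{i-1})$. Channel: input $\tilde x^n$ yields output $(x^n,z^n)$ with probability $P_{X^nZ^n}(x^n-\tilde x^n,z^n)$. $P_j(k,n)$ is the minimum over codes $(\mathsf e:\mathcal M^k\to\mathcal X^n,\ \mathsf d:(\mathcal X\times\mathcal Z)^n\to\mathcal M^k)$ of the average decoding error probability. $R:=\log|\mathcal X|$. Assumption 1: $\sum_xW_c(x,z|x',z')$ does not depend on $x'$;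 call it $W_{c,Z}(z|z')$. Entrywise powers $a^t$ of transition probabilities are $0$ when $a=0$; $\lambda(A)$ denotes the Perron–Frobenius eigenvalue. $\theta H^{W_s}_{1-\theta}(M):=\log\lambda\big(W_s(m|m')^{1-\theta}\big)$, $\theta H^{W_c,\downarrow}_{1-\theta}(X|Z):=\log\lambda\big(W_c(x,z|x',z')^{1-\theta}W_{c,Z}(z|z')^{\theta}\big)$. $H^{W_s}(M):=\lim_{\theta\to0}H^{W_s}_{1-\theta}(M)$, $V^{W_s}(M):=\lim_{\theta\to0}\frac{2[H^{W_s}_{1-\theta}(M)-H^{W_s}(M)]}{\theta}$, $H^{W_c}(X|Z):=\lim_{\theta\to0}H^{W_c,\downarrow}_{1-\theta}(X|Z)$, $V^{W_c}(X|Z):=\lim_{\theta\to0}\frac{2[H^{W_c,\downarrow}_{1-\theta}(X|Z)-H^{W_c}(X|Z)]}{\theta}$. *)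

theory Defs
  imports "HOL-Analysis.Analysis"
begin

text \<open>Conventions. A transition matrix on a finite type 'a is a function
  W :: 'a => 'a => real, where W a a' is the transition probability W(a|a')
  from the previous state a' to the next state a.\<close>

definition is_pmf :: "('a::finite \<Rightarrow> real) \<Rightarrow> bool" where
  "is_pmf P \<longleftrightarrow> (\<forall>a. P a \<ge> 0) \<and> (\<Sum>a\<in>UNIV. P a) = 1"

definition stochastic :: "('a::finite \<Rightarrow> 'a \<Rightarrow> real) \<Rightarrow> bool" where
  "stochastic W \<longleftrightarrow> (\<forall>a a'. W a a' \<ge> 0) \<and> (\<forall>a'. (\<Sum>a\<in>UNIV. W a a') = 1)"

fun mpow :: "('a::finite \<Rightarrow> 'a \<Rightarrow> real) \<Rightarrow> nat \<Rightarrow> 'a \<Rightarrow> 'a \<Rightarrow> real" where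
  "mpow W 0 = (\<lambda>a a'. if a = a' then 1 else 0)"
| "mpow W (Suc n) = (\<lambda>a a'. \<Sum>b\<in>UNIV. W a b * mpow W n b a')"

definition irreducible_mc :: "('a::finite \<Rightarrow> 'a \<Rightarrow> real) \<Rightarrow> bool" where
  "irreducible_mc W \<longleftrightarrow> (\<forall>a a'. \<exists>n>0. mpow W n a a' > 0)"

definition aperiodic_mc :: "('a::finite \<Rightarrow> 'a \<Rightarrow> real) \<Rightarrow> bool" where
  "aperiodic_mc W \<longleftrightarrow> (\<forall>a. Gcd {n::nat. n > 0 \<and> mpow W n a a > 0} = 1)"

text \<open>Perron--Frobenius eigenvalue of a nonnegative matrix = its spectral radius.\<close>
definition is_eigenvalue :: "('a::finite \<Rightarrow> 'a \<Rightarrow> real) \<Rightarrow> complex \<Rightarrow> bool" where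
  "is_eigenvalue A \<mu> \<longleftrightarrow> (\<exists>v::'a \<Rightarrow> complex. v \<noteq> (\<lambda>_. 0) \<and>
      (\<forall>a. (\<Sum>b\<in>UNIV. complex_of_real (A a b) * v b) = \<mu> * v a))"

definition pf_eig :: "('a::finite \<Rightarrow> 'a \<Rightarrow> real) \<Rightarrow> real" where
  "pf_eig A = Sup {cmod \<mu> | \<mu>. is_eigenvalue A \<mu>}"

text \<open>Entrywise powers use powr, for which 0 powr t = 0 (the stated convention). Logs are natural.\<close>

definition assumption1 :: "(('x::finite \<times> 'z::finite) \<Rightarrow> ('x \<times> 'z) \<Rightarrow> real) \<Rightarrow> bool" where
  "assumption1 Wc \<longleftrightarrow> (\<forall>z z' x1 x2. (\<Sum>x\<in>UNIV. Wc (x, z) (x1, z')) = (\<Sum>x\<in>UNIV. Wc (x, z) (x2, z')))"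

definition WcZ :: "(('x::{finite,zero} \<times> 'z::finite) \<Rightarrow> ('x \<times> 'z) \<Rightarrow> real) \<Rightarrow> 'z \<Rightarrow> 'z \<Rightarrow> real" where
  "WcZ Wc z z' = (\<Sum>x\<in>UNIV. Wc (x, z) (0, z'))"

definition Hs_renyi :: "('m::finite \<Rightarrow> 'm \<Rightarrow> real) \<Rightarrow> real \<Rightarrow> real" where
  "Hs_renyi Ws \<theta> = ln (pf_eig (\<lambda>m m'. Ws m m' powr (1 - \<theta>))) / \<theta>"

definition Hc_renyi :: "(('x::{finite,zero} \<times> 'z::finite) \<Rightarrow> ('x \<times> 'z) \<Rightarrow> real) \<Rightarrow> real \<Rightarrow> real" where
  "Hc_renyi Wc \<theta> = ln (pf_eig (\<lambda>(x, z) (x', z'). Wc (x, z) (x', z') powr (1 - \<theta>) * WcZ Wc z z' powr \<theta>)) / \<theta>"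

definition Hs :: "('m::finite \<Rightarrow> 'm \<Rightarrow> real) \<Rightarrow> real" where
  "Hs Ws = Lim (at 0) (Hs_renyi Ws)"

definition Vs :: "('m::finite \<Rightarrow> 'm \<Rightarrow> real) \<Rightarrow> real" where
  "Vs Ws = Lim (at 0) (\<lambda>\<theta>. 2 * (Hs_renyi Ws \<theta> - Hs Ws) / \<theta>)"

definition Hc :: "(('x::{finite,zero} \<times> 'z::finite) \<Rightarrow> ('x \<times> 'z) \<Rightarrow> real) \<Rightarrow> real" where
  "Hc Wc = Lim (at 0) (Hc_renyi Wc)"

definition Vc :: "(('x::{finite,zero} \<times> 'z::finite) \<Rightarrow> ('x \<times> 'z) \<Rightarrow> real) \<Rightarrow> real" where
  "Vc Wc = Lim (at 0) (\<lambda>\<theta>. 2 * (Hc_renyi Wc \<theta> - Hc Wc) / \<theta>)"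

definition markov_prob :: "('a \<Rightarrow> real) \<Rightarrow> ('a \<Rightarrow> 'a \<Rightarrow> real) \<Rightarrow> 'a list \<Rightarrow> real" where
  "markov_prob P1 W xs = (if xs = [] then 1
     else P1 (hd xs) * (\<Prod>i\<in>{1..<length xs}. W (xs ! i) (xs ! (i - 1))))"

text \<open>Average decoding error of encoder e : M^k -> X^n and decoder d : (X x Z)^n -> M^k.
  The channel output (x^n, z^n) occurs with probability P_{X^n Z^n}(x^n - e(m^k), z^n).\<close>
definition code_error ::
  "('m \<Rightarrow> real) \<Rightarrow> ('m \<Rightarrow> 'm \<Rightarrow> real) \<Rightarrow> (('x::ab_group_add \<times> 'z) \<Rightarrow> real) \<Rightarrow>
   (('x \<times> 'z) \<Rightarrow> ('x \<times> 'z) \<Rightarrow> real) \<Rightarrow> nat \<Rightarrow> nat \<Rightarrow>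
   ('m list \<Rightarrow> 'x list) \<Rightarrow> (('x \<times> 'z) list \<Rightarrow> 'm list) \<Rightarrow> real" where
  "code_error PM1 Ws PXZ1 Wc k n e d =
     (\<Sum>ms\<in>{ms. length ms = k}. markov_prob PM1 Ws ms *
        (\<Sum>ys\<in>{ys. length ys = n \<and> d ys \<noteq> ms}.
            markov_prob PXZ1 Wc (map2 (\<lambda>(x, z) xt. (x - xt, z)) ys (e ms))))"

definition Pj ::
  "('m \<Rightarrow> real) \<Rightarrow> ('m \<Rightarrow> 'm \<Rightarrow> real) \<Rightarrow> (('x::ab_group_add \<times> 'z) \<Rightarrow> real) \<Rightarrow>
   (('x \<times> 'z) \<Rightarrow> ('x \<times> 'z) \<Rightarrow> real) \<Rightarrow> nat \<Rightarrow> nat \<Rightarrow> real" where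
  "Pj PM1 Ws PXZ1 Wc k n =
     Inf {code_error PM1 Ws PXZ1 Wc k n e d | e d.
            \<forall>ms. length ms = k \<longrightarrow> length (e ms) = n}"

end

theory Submission
  imports Defs "HOL-Real_Asymp.Real_Asymp"
begin

text \<open>Write \<open>A = - ln P(M) - ln P(X|Z) - n ln |X|\<close>. Random coding bounds the error from above by
  \<open>E (min 1 (exp A)) \<le> E (exp (\<theta> A))\<close> for \<open>0 \<le> \<theta> \<le> 1\<close>, and every code has error at least
  \<open>Pr (A \<ge> g) - exp (- g)\<close>. Assumption 1 makes \<open>Z\<close> a Markov chain, so \<open>E (exp (\<theta> A))\<close> is a product of
  path sums of the tilted matrices that define the Renyi entropies. Solving two Poisson equations gives a
  positive vector \<open>u\<close> with \<open>u A\<^sub>\<theta> = exp (H \<theta> + V \<theta>\<^sup>2 / 2 + o(\<theta>\<^sup>2)) u\<close>; it controls the Perron-Frobenius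
  eigenvalue by the Collatz-Wielandt inequalities and the path sums by iteration, so no exact
  eigenvector is needed. With \<open>\<theta> = a n^(-t)\<close> the logarithm of \<open>E (exp (\<theta> A))\<close>, divided by \<open>n^(1-2t)\<close>,
  tends to a quadratic in \<open>a\<close>; minimising it gives the upper bound, and the lower bound of
  Gaertner-Ellis type follows by an exponential change of measure.\<close>

section \<open>Poisson equations and Perron-Frobenius eigenvalues\<close>

text \<open>The scales shape the proof. With s = n^(1-2t) and \<theta> = a n^(-t) one has n
  \<theta>^2 = a^2 s, so an error o(\<theta>^2) per letter, uniform in the block length, is just
  affordable. Limits of eigenvalues alone would say nothing about sums over words whose tilt shrinks
  as the words grow; the explicit vector \<open>u\<close> supplies this uniformity. The first-order
  terms are of order n^(1-t), much larger than s, and must cancel: k H - n C = - \<delta> H n^(1-t)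
  + O(1) leaves - \<kappa> a s with \<kappa> = \<delta> H. As k / n tends to C / H, the quadratic in
  the overview is a^2 V / 2 - \<kappa> a with V = (C / H) V(M) + V(X|Z). Its minimum, at a =
  \<kappa> / V, is - \<kappa>^2 / (2 V). Both coding bounds are sharp on this scale. The constraint
  \<theta> \<le> 1 is harmless because \<theta> tends to 0. In the converse g is taken of order s,
  which is negligible against n^(1-t), the scale of A, so the threshold on A / n^(1-t) tends to 0.
  Every probability is a finite sum over words, and tilted weights are left unnormalised.\<close>

lemma harmonic_mpow:
  assumes "\<And>a. (\<Sum>b\<in>UNIV. W b a * g b) = g a"
  shows "(\<Sum>b\<in>UNIV. mpow W n b a * g b) = g a"
proof (induction n)
  case 0
  show ?case by (simp add: if_distrib[of "\<lambda>x. x * _"] cong: if_cong)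
next
  case (Suc n)
  have "(\<Sum>b\<in>UNIV. mpow W (Suc n) b a * g b) = (\<Sum>b\<in>UNIV. \<Sum>c\<in>UNIV. W b c * mpow W n c a * g b)"
    by (simp add: sum_distrib_right)
  also have "\<dots> = (\<Sum>c\<in>UNIV. \<Sum>b\<in>UNIV. W b c * mpow W n c a * g b)"
    by (rule sum.swap)
  also have "\<dots> = (\<Sum>c\<in>UNIV. mpow W n c a * (\<Sum>b\<in>UNIV. W b c * g b))"
    by (simp add: sum_distrib_left algebra_simps)
  also have "\<dots> = g a" using Suc by (simp add: assms)
  finally show ?case .
qed

lemma mpow_nonneg: "stochastic W \<Longrightarrow> mpow W n a b \<ge> 0"
  by (induction n arbitrary: a b) (auto simp: stochastic_def intro!: sum_nonneg mult_nonneg_nonneg)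

lemma finite_type_attains_max:
  fixes g :: "'a::finite \<Rightarrow> real"
  obtains m where "\<And>b. g b \<le> g m"
proof -
  have "Max (range g) \<in> range g" by (rule Max_in) auto
  then obtain m where "Max (range g) = g m" by blast
  hence "g b \<le> g m" for b using Max_ge[of "range g" "g b"] by auto
  thus ?thesis by (rule that)
qed

text \<open>Maximum principle: at a maximiser \<open>m\<close> the value \<open>g m\<close> is the
  average of \<open>g\<close> under every \<open>mpow W n\<close>, so \<open>g\<close> equals its
  maximum at each state reached from \<open>m\<close> with positive weight, and irreducibility
  reaches them all.\<close>

lemma harmonic_imp_constant:
  assumes st: "stochastic W" and ir: "irreducible_mc W"
    and harm: "\<And>a. (\<Sum>b\<in>UNIV. W b a * g b) = (g a :: real)"
  shows "g x = g y"
proof -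
  obtain m where m: "\<And>b. g b \<le> g m" by (rule finite_type_attains_max[of g]) blast
  have "g b = g m" for b
  proof -
    obtain n where n: "mpow W n b m > 0" using ir by (auto simp: irreducible_mc_def)
    have one: "(\<Sum>b\<in>UNIV. mpow W n b m * 1) = 1"
      by (rule harmonic_mpow[of W "\<lambda>_. 1"]) (use st in \<open>auto simp: stochastic_def\<close>)
    have "(\<Sum>b\<in>UNIV. mpow W n b m * (g m - g b)) = g m * (\<Sum>b\<in>UNIV. mpow W n b m * 1) - (\<Sum>b\<in>UNIV. mpow W n b m * g b)"
      by (simp add: sum_subtractf algebra_simps sum_distrib_left)
    also have "\<dots> = 0" unfolding one harmonic_mpow[OF harm] by simp
    finally have "mpow W n b m * (g m - g b) = 0"
      using m by (subst (asm) sum_nonneg_eq_0_iff) (auto intro!: mult_nonneg_nonneg mpow_nonneg st)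
    thus ?thesis using n by auto
  qed
  thus ?thesis by metis
qed

text \<open>The range of \<open>g - W g\<close> has codimension one, so \<open>F\<close> can only be
  attained up to a constant. Adding the evaluation at a reference state \<open>a0\<close> gives an
  injective, hence surjective, linear map, and the constant \<open>c\<close> is the value of the
  solution at \<open>a0\<close>.\<close>

lemma poisson_equation:
  fixes F :: "'a::finite \<Rightarrow> real"
  assumes st: "stochastic W" and ir: "irreducible_mc W"
  obtains g c where "\<And>a. g a = (\<Sum>b\<in>UNIV. W b a * g b) + F a - c"
proof -
  fix a0 :: 'a
  define L :: "real^'a \<Rightarrow> real^'a"
    where "L = (\<lambda>g. \<chi> a. g $ a - (\<Sum>b\<in>UNIV. W b a * g $ b) + g $ a0)"
  have lin: "linear L"
    by (rule linearI) (auto simp: L_def vec_eq_iff sum.distrib sum_distrib_left algebra_simps)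
  have "inj L"
  proof (subst linear_injective_0[OF lin], intro allI impI)
    fix v assume "L v = 0"
    hence eq: "v $ a - (\<Sum>b\<in>UNIV. W b a * v $ b) = - v $ a0" for a
      by (auto simp: L_def vec_eq_iff algebra_simps eq_neg_iff_add_eq_0)
    have W0: "W b a \<ge> 0" and W1: "(\<Sum>b\<in>UNIV. W b a) = 1" for a b
      using st by (auto simp: stochastic_def)
    \<comment> \<open>The left side of \<open>eq\<close> is nonnegative at a maximum of
      \<open>v\<close> and nonpositive at a minimum, while the right side is a constant; so the
      constant is 0 and \<open>v\<close> is harmonic.\<close>
    obtain m where m: "\<And>b. v $ b \<le> v $ m"
      by (rule finite_type_attains_max[of "($) v"]) blast
    obtain l where l: "\<And>b. v $ l \<le> v $ b"
      by (rule finite_type_attains_max[of "\<lambda>b. - (v $ b)"]) auto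
    have "(\<Sum>b\<in>UNIV. W b m * v $ b) \<le> (\<Sum>b\<in>UNIV. W b m * v $ m)"
      by (intro sum_mono mult_left_mono m W0)
    also have "\<dots> = v $ m" by (simp add: sum_distrib_right[symmetric] W1)
    finally have 1: "v $ a0 \<le> 0" using eq[of m] by simp
    have "(\<Sum>b\<in>UNIV. W b l * v $ b) \<ge> (\<Sum>b\<in>UNIV. W b l * v $ l)"
      by (intro sum_mono mult_left_mono l W0)
    also have "(\<Sum>b\<in>UNIV. W b l * v $ l) = v $ l" by (simp add: sum_distrib_right[symmetric] W1)
    finally have 2: "v $ a0 \<ge> 0" using eq[of l] by simp
    have a0: "v $ a0 = 0" using 1 2 by simp
    have "(\<Sum>b\<in>UNIV. W b a * v $ b) = v $ a" for a
      using eq[of a] a0 by simp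
    hence "v $ b = v $ a0" for b
      by (rule harmonic_imp_constant[OF st ir])
    thus "v = 0" using a0 by (simp add: vec_eq_iff)
  qed
  hence "surj L" by (intro linear_injective_imp_surjective[OF lin]) auto
  then obtain v where v: "L v = (\<chi> a. F a)" by (metis surjD)
  have "v $ a = (\<Sum>b\<in>UNIV. W b a * v $ b) + F a - v $ a0" for a
    using arg_cong[OF v, of "\<lambda>x. x $ a"] by (simp add: L_def)
  thus ?thesis by (rule that)
qed

text \<open>The sum is 1 + H \<theta> + c \<theta>^2 + o(\<theta>^2), and the quadratic term of ln
  (1 + y) subtracts H^2 / 2. The second-order part \<open>q\<close> of the exponent leaves room for
  a corrector at order \<theta>^2.\<close>

lemma ln_sum_exp_expansion:
  fixes w p q :: "'b::finite \<Rightarrow> real"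
  assumes w1: "(\<Sum>b\<in>UNIV. w b) = 1" and H: "(\<Sum>b\<in>UNIV. w b * p b) = H"
    and c: "(\<Sum>b\<in>UNIV. w b * (q b + (p b)\<^sup>2 / 2)) = c"
  shows "((\<lambda>\<theta>. (ln (\<Sum>b\<in>UNIV. w b * exp (\<theta> * p b + \<theta>\<^sup>2 * q b)) - H * \<theta>) / \<theta>\<^sup>2)
           \<longlongrightarrow> c - H\<^sup>2 / 2) (at 0)"
proof -
  define s where "s = (\<lambda>\<theta>. (\<Sum>b\<in>UNIV. w b * exp (\<theta> * p b + \<theta>\<^sup>2 * q b)) - 1)"
  \<comment> \<open>\<open>s\<close> may vanish at \<theta> other than 0, so the removable
    singularity is filled in before \<open>s\<close> is substituted.\<close>
  define r where "r = (\<lambda>y::real. if y = 0 then -1/2 else (ln (1 + y) - y) / y\<^sup>2)"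
  have r: "(r \<longlongrightarrow> -1/2) (nhds 0)"
  proof -
    have "((\<lambda>y::real. (ln (1 + y) - y) / y\<^sup>2) \<longlongrightarrow> -1/2) (at 0)"
      by real_asymp
    hence "(r \<longlongrightarrow> -1/2) (at 0)"
      by (rule Lim_transform_eventually) (auto simp: r_def eventually_at_filter)
    thus ?thesis
      by (simp add: tendsto_nhds_iff r_def)
  qed
  have e: "((\<lambda>\<theta>. (exp (\<theta> * P + \<theta>\<^sup>2 * Q) - 1 - \<theta> * P) / \<theta>\<^sup>2) \<longlongrightarrow> Q + P\<^sup>2/2) (at 0)" for P Q :: real
  proof -
    have "((\<lambda>\<theta>. (exp (\<theta> * P + \<theta>\<^sup>2 * Q) - 1 - \<theta> * P) / \<theta>\<^sup>2) \<longlongrightarrow> P * P/2 + Q) (at 0)"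
      by real_asymp
    thus ?thesis by (simp add: power2_eq_square add.commute)
  qed
  have "((\<lambda>\<theta>. \<Sum>b\<in>UNIV. w b * ((exp (\<theta> * p b + \<theta>\<^sup>2 * q b) - 1 - \<theta> * p b) / \<theta>\<^sup>2)) \<longlongrightarrow> (\<Sum>b\<in>UNIV. w b * (q b + (p b)\<^sup>2/2))) (at 0)"
    by (intro tendsto_intros e)
  also have "(\<lambda>\<theta>. \<Sum>b\<in>UNIV. w b * ((exp (\<theta> * p b + \<theta>\<^sup>2 * q b) - 1 - \<theta> * p b) / \<theta>\<^sup>2)) = (\<lambda>\<theta>. (s \<theta> - H * \<theta>) / \<theta>\<^sup>2)"
  proof
    fix \<theta>
    have "s \<theta> - H * \<theta> = (\<Sum>b\<in>UNIV. w b * (exp (\<theta> * p b + \<theta>\<^sup>2 * q b) - 1 - \<theta> * p b))"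
      using w1 H[symmetric]
      by (simp add: s_def right_diff_distrib sum_subtractf sum_distrib_left mult.left_commute mult.commute[of _ \<theta>])
    thus "(\<Sum>b\<in>UNIV. w b * ((exp (\<theta> * p b + \<theta>\<^sup>2 * q b) - 1 - \<theta> * p b) / \<theta>\<^sup>2)) = (s \<theta> - H * \<theta>) / \<theta>\<^sup>2"
      by (simp add: sum_divide_distrib)
  qed
  finally have s2: "((\<lambda>\<theta>. (s \<theta> - H * \<theta>) / \<theta>\<^sup>2) \<longlongrightarrow> c)  (at 0)" by (simp only: c)
  have "((\<lambda>\<theta>. (s \<theta> - H * \<theta>) / \<theta>\<^sup>2 * \<theta> + H) \<longlongrightarrow> c * 0 + H) (at 0)"
    by (intro tendsto_intros s2)
  moreover have "\<forall>\<^sub>F \<theta> in at 0. (s \<theta> - H * \<theta>) / \<theta>\<^sup>2 * \<theta> + H = s \<theta> / \<theta>"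
    unfolding eventually_at_filter by (rule always_eventually) (auto simp: power2_eq_square field_simps)
  ultimately have "((\<lambda>\<theta>. s \<theta> / \<theta>) \<longlongrightarrow> c * 0 + H) (at 0)" by (rule Lim_transform_eventually)
  hence s1: "((\<lambda>\<theta>. s \<theta> / \<theta>) \<longlongrightarrow> H) (at 0)" by simp
  have "((\<lambda>\<theta>. s \<theta> / \<theta> * \<theta>) \<longlongrightarrow> H * 0) (at 0)" by (intro tendsto_intros s1)
  moreover have "\<forall>\<^sub>F \<theta> in at 0. s \<theta> / \<theta> * \<theta> = s \<theta>"
    by (simp add: eventually_at_filter)
  ultimately have "((\<lambda>\<theta>. s \<theta>) \<longlongrightarrow> H * 0) (at 0)" by (rule Lim_transform_eventually)
  hence "((\<lambda>\<theta>. s \<theta>) \<longlongrightarrow> 0) (at 0)" by simp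
  hence "((\<lambda>\<theta>. r (s \<theta>)) \<longlongrightarrow> -1/2) (at 0)"
    by (rule filterlim_compose[OF r])
  hence "((\<lambda>\<theta>. (s \<theta> - H * \<theta>) / \<theta>\<^sup>2 + r (s \<theta>) * (s \<theta> / \<theta>)\<^sup>2) \<longlongrightarrow> c + (-1/2) * H\<^sup>2) (at 0)"
    by (intro tendsto_intros s2 s1)
  moreover have "(s \<theta> - H * \<theta>) / \<theta>\<^sup>2 + r (s \<theta>) * (s \<theta> / \<theta>)\<^sup>2 = (ln (1 + s \<theta>) - H * \<theta>) / \<theta>\<^sup>2" for \<theta>
  proof (cases "s \<theta> = 0")
    case False
    hence "r (s \<theta>) * (s \<theta> / \<theta>)\<^sup>2 = (ln (1 + s \<theta>) - s \<theta>) / \<theta>\<^sup>2"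
      by (simp add: r_def power_divide)
    thus ?thesis by (simp add: diff_divide_distrib)
  qed simp
  ultimately show ?thesis by (simp add: s_def)
qed

text \<open>The vector \<open>u = exp (\<theta> g + \<theta>\<^sup>2 h)\<close>, with \<open>g\<close> and \<open>h\<close> solutions of two Poisson
  equations, makes the ratio \<open>(u A) a / u a\<close> independent of \<open>a\<close> up to \<open>o(\<theta>\<^sup>2)\<close>.\<close>

lemma tilted_approx_eigenvector:
  fixes W :: "'a::finite \<Rightarrow> 'a \<Rightarrow> real"
  assumes st: "stochastic W" and ir: "irreducible_mc W"
  shows "\<exists>H v. \<forall>\<epsilon>>0. \<forall>\<^sub>F \<theta> in at 0. \<exists>u. \<forall>a. 1/2 \<le> u a \<and> u a \<le> 2 \<and>
      exp (H * \<theta> + v * \<theta>\<^sup>2 / 2 - \<epsilon> * \<theta>\<^sup>2) * u a \<le> (\<Sum>b\<in>UNIV. u b * (W b a * exp (\<theta> * f b a))) \<and>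
      (\<Sum>b\<in>UNIV. u b * (W b a * exp (\<theta> * f b a))) \<le> exp (H * \<theta> + v * \<theta>\<^sup>2 / 2 + \<epsilon> * \<theta>\<^sup>2) * u a"
proof -
  have W0: "W b a \<ge> 0" and W1: "(\<Sum>b\<in>UNIV. W b a) = 1" for a b
    using st by (auto simp: stochastic_def)
  obtain g H where g: "\<And>a. g a = (\<Sum>b\<in>UNIV. W b a * g b) + (\<Sum>b\<in>UNIV. W b a * f b a) - H"
    using poisson_equation[OF st ir, of "\<lambda>a. \<Sum>b\<in>UNIV. W b a * f b a"] by metis
  \<comment> \<open>The corrector \<open>g\<close> is folded into the increment: with this
    coboundary added, \<open>f\<close> has the same conditional mean \<open>H\<close> from every
    state.\<close>
  define p where "p = (\<lambda>a b. f b a + g b - g a)"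
  have pH: "(\<Sum>b\<in>UNIV. W b a * p a b) = H" for a
    using g[of a] W1[of a]
    by (simp add: p_def algebra_simps sum.distrib sum_subtractf sum_distrib_left[symmetric])
  \<comment> \<open>The second-order coefficient still depends on the state; a corrector
    \<open>h\<close> at order \<theta>^2 levels it to \<open>c\<close>.\<close>
  obtain h c where h: "\<And>a. h a = (\<Sum>b\<in>UNIV. W b a * h b) + (\<Sum>b\<in>UNIV. W b a * ((p a b)\<^sup>2/2)) - c"
    using poisson_equation[OF st ir, of "\<lambda>a. \<Sum>b\<in>UNIV. W b a * ((p a b)\<^sup>2/2)"] by metis
  define q where "q = (\<lambda>a b. h b - h a)"
  have qc: "(\<Sum>b\<in>UNIV. W b a * (q a b + (p a b)\<^sup>2/2)) = c" for a
    using h[of a] W1[of a]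
    by (simp add: q_def ring_distribs sum.distrib sum_subtractf sum_distrib_right[symmetric] right_diff_distrib)
  \<comment> \<open>\<open>ln_sum_exp_expansion\<close> yields the coefficient c - H^2 / 2, which is
    to be v / 2.\<close>
  define v where "v = 2 * c - H\<^sup>2"
  \<comment> \<open>\<open>R a \<theta>\<close> is the ratio of \<open>u A\<close> to
    \<open>u\<close> at \<open>a\<close>, for the exponential vector \<open>u\<close> defined
    below.\<close>
  define R where "R = (\<lambda>a \<theta>. \<Sum>b\<in>UNIV. W b a * exp (\<theta> * p a b + \<theta>\<^sup>2 * q a b))"
  have lim: "((\<lambda>\<theta>. (ln (R a \<theta>) - H * \<theta>) / \<theta>\<^sup>2) \<longlongrightarrow> v / 2) (at 0)" for a
    using ln_sum_exp_expansion[OF W1 pH qc, of a] by (simp add: R_def v_def diff_divide_distrib)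
  have R0: "R a \<theta> > 0" for a \<theta>
  proof -
    have "\<exists>b. W b a \<noteq> 0" using W1[of a] by (metis sum.neutral zero_neq_one)
    then obtain b where "W b a > 0" using W0 by (metis order_le_less)
    thus ?thesis unfolding R_def by (intro sum_pos2[of _ b]) (auto intro!: mult_nonneg_nonneg W0)
  qed
  have "\<forall>\<^sub>F \<theta> in at 0. \<exists>u. \<forall>a. 1/2 \<le> u a \<and> u a \<le> 2 \<and>
      exp (H * \<theta> + v * \<theta>\<^sup>2 / 2 - \<epsilon> * \<theta>\<^sup>2) * u a \<le> (\<Sum>b\<in>UNIV. u b * (W b a * exp (\<theta> * f b a))) \<and>
      (\<Sum>b\<in>UNIV. u b * (W b a * exp (\<theta> * f b a))) \<le> exp (H * \<theta> + v * \<theta>\<^sup>2 / 2 + \<epsilon> * \<theta>\<^sup>2) * u a"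
    if "\<epsilon> > 0" for \<epsilon>
  proof -
    have "\<forall>\<^sub>F \<theta> in at 0. \<forall>a. dist ((ln (R a \<theta>) - H * \<theta>) / \<theta>\<^sup>2) (v/2) < \<epsilon>"
      by (intro eventually_all_finite tendstoD lim that)
    \<comment> \<open>\<open>u\<close> tends to 1; fixing it between 1/2 and 2 lets the path-sum
      estimates drop it at a cost independent of the length.\<close>
    moreover have "\<forall>\<^sub>F \<theta> in at 0. \<forall>a. dist (exp (\<theta> * g a + \<theta>\<^sup>2 * h a)) 1 < 1/2"
    proof (intro eventually_all_finite tendstoD)
      have "((\<lambda>\<theta>. exp (\<theta> * g a + \<theta>\<^sup>2 * h a)) \<longlongrightarrow> exp (0 * g a + 0\<^sup>2 * h a)) (at 0)" for a
        by (intro tendsto_intros)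
      thus "((\<lambda>\<theta>. exp (\<theta> * g a + \<theta>\<^sup>2 * h a)) \<longlongrightarrow> 1) (at 0)" for a by simp
    qed auto
    moreover have "\<forall>\<^sub>F \<theta>::real in at 0. \<theta> \<noteq> 0" by (simp add: eventually_at_filter)
    ultimately show ?thesis
    proof eventually_elim
      case (elim \<theta>)
      define u where "u = (\<lambda>a. exp (\<theta> * g a + \<theta>\<^sup>2 * h a))"
      have eq: "(\<Sum>b\<in>UNIV. u b * (W b a * exp (\<theta> * f b a))) = exp (ln (R a \<theta>)) * u a" for a
      proof -
        have "(\<Sum>b\<in>UNIV. u b * (W b a * exp (\<theta> * f b a))) = R a \<theta> * u a"
          unfolding R_def sum_distrib_right
          by (rule sum.cong) (auto simp: u_def p_def q_def algebra_simps exp_add[symmetric])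
        thus ?thesis using R0 by simp
      qed
      have u: "1/2 \<le> u a \<and> u a \<le> 2" for a
        using elim(2)[rule_format, of a] unfolding u_def dist_real_def by linarith
      have "\<bar>ln (R a \<theta>) - H * \<theta> - v * \<theta>\<^sup>2 / 2\<bar> < \<epsilon> * \<theta>\<^sup>2" for a
      proof -
        have "\<bar>(ln (R a \<theta>) - H * \<theta>) / \<theta>\<^sup>2 - v/2\<bar> * \<theta>\<^sup>2 < \<epsilon> * \<theta>\<^sup>2"
          using elim by (intro mult_strict_right_mono) (auto simp: dist_real_def)
        also have "\<bar>(ln (R a \<theta>) - H * \<theta>) / \<theta>\<^sup>2 - v/2\<bar> * \<theta>\<^sup>2 = \<bar>((ln (R a \<theta>) - H * \<theta>) / \<theta>\<^sup>2 - v/2) * \<theta>\<^sup>2\<bar>"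
          by (simp add: abs_mult)
        also have "((ln (R a \<theta>) - H * \<theta>) / \<theta>\<^sup>2 - v/2) * \<theta>\<^sup>2 = ln (R a \<theta>) - H * \<theta> - v * \<theta>\<^sup>2 / 2"
          using elim(3) by (simp add: field_simps)
        finally show ?thesis .
      qed
      hence l: "H * \<theta> + v * \<theta>\<^sup>2 / 2 - \<epsilon> * \<theta>\<^sup>2 \<le> ln (R a \<theta>) \<and> ln (R a \<theta>) \<le> H * \<theta> + v * \<theta>\<^sup>2 / 2 + \<epsilon> * \<theta>\<^sup>2" for a
        by (smt (verit))
      show ?case
      proof (intro exI[of _ u] allI conjI)
        fix a
        have "u a \<ge> 0" by (simp add: u_def)
        thus "exp (H * \<theta> + v * \<theta>\<^sup>2 / 2 - \<epsilon> * \<theta>\<^sup>2) * u a \<le> (\<Sum>b\<in>UNIV. u b * (W b a * exp (\<theta> * f b a)))"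
          "(\<Sum>b\<in>UNIV. u b * (W b a * exp (\<theta> * f b a))) \<le> exp (H * \<theta> + v * \<theta>\<^sup>2 / 2 + \<epsilon> * \<theta>\<^sup>2) * u a"
          unfolding eq using l[of a] by (auto intro!: mult_right_mono)
      qed (use u in auto)
    qed
  qed
  thus ?thesis by (intro exI[of _ H] exI[of _ v]) simp
qed

text \<open>Moduli in the eigenvalue equation give |\<mu>| |v| \<le> A |v|. Pairing with the left
  vector \<open>u\<close> then compares |\<mu>| and \<beta> as factors of the same positive number,
  the sum of \<open>u a * cmod (v a)\<close>.\<close>

lemma eigenvalue_le_of_subinvariant:
  fixes A :: "'a::finite \<Rightarrow> 'a \<Rightarrow> real"
  assumes A0: "\<And>a b. A a b \<ge> 0" and u0: "\<And>a. u a > 0"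
    and up: "\<And>a. (\<Sum>b\<in>UNIV. u b * A b a) \<le> \<beta> * u a" and ev: "is_eigenvalue A \<mu>"
  shows "cmod \<mu> \<le> \<beta>"
proof -
  obtain v where v: "v \<noteq> (\<lambda>_. 0)" "\<And>a. (\<Sum>b\<in>UNIV. complex_of_real (A a b) * v b) = \<mu> * v a"
    using ev by (auto simp: is_eigenvalue_def)
  have "cmod \<mu> * cmod (v a) \<le> (\<Sum>b\<in>UNIV. A a b * cmod (v b))" for a
  proof -
    have "cmod \<mu> * cmod (v a) = cmod (\<Sum>b\<in>UNIV. complex_of_real (A a b) * v b)"
      by (simp add: v(2) norm_mult)
    also have "\<dots> \<le> (\<Sum>b\<in>UNIV. A a b * cmod (v b))"
      by (rule order_trans[OF norm_sum]) (simp add: norm_mult A0)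
    finally show ?thesis .
  qed
  hence "(\<Sum>a\<in>UNIV. u a * (cmod \<mu> * cmod (v a))) \<le> (\<Sum>a\<in>UNIV. u a * (\<Sum>b\<in>UNIV. A a b * cmod (v b)))"
    by (intro sum_mono mult_left_mono) (auto intro: less_imp_le u0)
  also have "\<dots> = (\<Sum>b\<in>UNIV. (\<Sum>a\<in>UNIV. u a * A a b) * cmod (v b))"
    unfolding sum_distrib_left sum_distrib_right by (subst sum.swap) (simp add: mult.assoc)
  also have "\<dots> \<le> (\<Sum>b\<in>UNIV. (\<beta> * u b) * cmod (v b))"
    by (intro sum_mono mult_right_mono up) auto
  finally have "cmod \<mu> * (\<Sum>a\<in>UNIV. u a * cmod (v a)) \<le> \<beta> * (\<Sum>a\<in>UNIV. u a * cmod (v a))"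
    by (simp add: sum_distrib_left algebra_simps)
  moreover have "(\<Sum>a\<in>UNIV. u a * cmod (v a)) > 0"
  proof -
    obtain i where "v i \<noteq> 0" using v(1) by auto
    thus ?thesis using u0 by (intro sum_pos2[of _ i]) (auto intro!: mult_nonneg_nonneg less_imp_le[OF u0])
  qed
  ultimately show ?thesis by simp
qed

text \<open>Brouwer's theorem for the map A x / N x on the probability simplex, where N x is the sum
  of the entries of A x. Positive column sums keep \<open>N\<close> positive there, and its value at
  the fixed point is the eigenvalue.\<close>

lemma nonneg_eigenvector_exists:
  fixes A :: "'a::finite \<Rightarrow> 'a \<Rightarrow> real"
  assumes A0: "\<And>a b. A a b \<ge> 0" and Apos: "\<And>b. (\<Sum>a\<in>UNIV. A a b) > 0"
  shows "\<exists>v \<mu>. (\<forall>a. v a \<ge> 0) \<and> (\<Sum>a\<in>UNIV. v a) = 1 \<and> \<mu> > 0 \<and>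
    (\<forall>a. (\<Sum>b\<in>UNIV. A a b * v b) = \<mu> * v a)"
proof -
  define S where "S = {x::real^'a. (\<forall>i. 0 \<le> x $ i) \<and> (\<Sum>i\<in>UNIV. x $ i) = 1}"
  define N where "N = (\<lambda>x::real^'a. \<Sum>a\<in>UNIV. \<Sum>b\<in>UNIV. A a b * x $ b)"
  define T where "T = (\<lambda>x::real^'a. \<chi> a. (\<Sum>b\<in>UNIV. A a b * x $ b) / N x)"
  have N: "N x > 0" if "x \<in> S" for x
  proof -
    have "N x = (\<Sum>b\<in>UNIV. (\<Sum>a\<in>UNIV. A a b) * x $ b)"
      unfolding N_def by (subst sum.swap) (simp add: sum_distrib_right)
    moreover have "\<exists>b. x $ b \<noteq> 0"
      using that unfolding S_def by (metis (mono_tags, lifting) mem_Collect_eq sum.neutral zero_neq_one)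
    then obtain b where b: "x $ b \<noteq> 0" by blast
    have x0: "x $ b \<ge> 0" for b using that by (simp add: S_def)
    hence "x $ b > 0" using b by (simp add: order_less_le)
    hence "(\<Sum>b\<in>UNIV. (\<Sum>a\<in>UNIV. A a b) * x $ b) > 0"
      by (intro sum_pos2[of _ b] mult_pos_pos Apos mult_nonneg_nonneg less_imp_le[OF Apos] x0) auto
    ultimately show ?thesis by simp
  qed
  have "compact S"
  proof (rule compact_eq_bounded_closed[THEN iffD2], intro conjI)
    show "bounded S" unfolding bounded_iff
    proof (intro exI ballI)
      fix x assume x: "x \<in> S"
      have "norm x \<le> (\<Sum>i\<in>UNIV. \<bar>x $ i\<bar>)" by (rule norm_le_l1_cart)
      also have "\<dots> = 1" using x by (simp add: S_def)
      finally show "norm x \<le> 1" .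
    qed
    have "S = (\<Inter>i. {x. 0 \<le> x $ i}) \<inter> {x. (\<Sum>i\<in>UNIV. x $ i) = 1}" by (auto simp: S_def)
    thus "closed S"
      by (auto intro!: closed_Int closed_INT closed_Collect_le closed_Collect_eq continuous_intros)
  qed
  moreover have "convex S"
    by (auto simp: convex_def S_def sum.distrib sum_distrib_left[symmetric])
  moreover have "S \<noteq> {}"
  proof -
    fix a0 :: 'a
    have "axis a0 1 \<in> S" by (auto simp: S_def axis_def)
    thus ?thesis by auto
  qed
  moreover have "continuous_on S T"
    unfolding T_def N_def using N by (auto intro!: continuous_intros simp: N_def order_less_le)
  moreover have "T \<in> S \<rightarrow> S"
  proof
    fix x assume x: "x \<in> S"
    have "(\<Sum>i\<in>UNIV. T x $ i) = 1"
      using N[OF x] by (simp add: T_def sum_divide_distrib[symmetric] N_def)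
    moreover have "T x $ i \<ge> 0" for i
      using x N[OF x] by (auto simp: T_def S_def intro!: divide_nonneg_pos sum_nonneg mult_nonneg_nonneg A0)
    ultimately show "T x \<in> S" by (simp add: S_def)
  qed
  ultimately obtain x where x: "x \<in> S" "T x = x" using brouwer by metis
  have "(\<Sum>b\<in>UNIV. A a b * x $ b) = N x * x $ a" for a
  proof -
    have "T x $ a = x $ a" by (simp add: x)
    thus ?thesis using N[OF x(1)] by (simp add: T_def field_simps)
  qed
  thus ?thesis using N[OF x(1)] x(1) by (intro exI[of _ "($) x"] exI[of _ "N x"]) (simp add: S_def)
qed

text \<open>\<open>pf_eig\<close> is a supremum over complex eigenvalues. Subinvariance of
  \<open>u\<close> bounds them all, which also makes the supremum meaningful. From below one
  eigenvalue suffices: pairing \<open>u\<close> with the nonnegative eigenvector \<open>v\<close>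
  gives \<alpha> <u,v> \<le> \<mu> <u,v>.\<close>

lemma pf_eig_Collatz_Wielandt:
  fixes A :: "'a::finite \<Rightarrow> 'a \<Rightarrow> real"
  assumes A0: "\<And>a b. A a b \<ge> 0" and Apos: "\<And>b. (\<Sum>a\<in>UNIV. A a b) > 0" and u0: "\<And>a. u a > 0"
    and lo: "\<And>a. \<alpha> * u a \<le> (\<Sum>b\<in>UNIV. u b * A b a)"
    and up: "\<And>a. (\<Sum>b\<in>UNIV. u b * A b a) \<le> \<beta> * u a"
  shows "\<alpha> \<le> pf_eig A" and "pf_eig A \<le> \<beta>"
proof -
  obtain v \<mu> where v: "\<And>a. v a \<ge> 0" "(\<Sum>a\<in>UNIV. v a) = 1" "\<mu> > 0"
    "\<And>a. (\<Sum>b\<in>UNIV. A a b * v b) = \<mu> * v a"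
    using nonneg_eigenvector_exists[of A, OF A0 Apos] by blast
  have ev: "is_eigenvalue A (complex_of_real \<mu>)"
    unfolding is_eigenvalue_def
  proof (intro exI[of _ "\<lambda>a. complex_of_real (v a)"] conjI allI)
    show "(\<lambda>a. complex_of_real (v a)) \<noteq> (\<lambda>_. 0)"
      using v(2) by (metis (mono_tags, lifting) of_real_eq_0_iff sum.neutral zero_neq_one)
    show "(\<Sum>b\<in>UNIV. complex_of_real (A a b) * complex_of_real (v b)) = complex_of_real \<mu> * complex_of_real (v a)" for a
      unfolding of_real_mult[symmetric] of_real_sum[symmetric] v(4) ..
  qed
  have bd: "cmod x \<le> \<beta>" if "is_eigenvalue A x" for x
    by (rule eigenvalue_le_of_subinvariant[OF A0 u0 up that])
  have pos: "(\<Sum>a\<in>UNIV. u a * v a) > 0"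
  proof -
    obtain i where "v i \<noteq> 0" using v(2) by (metis sum.neutral zero_neq_one)
    hence "v i > 0" using v(1)[of i] by simp
    thus ?thesis
      by (intro sum_pos2[of _ i] mult_pos_pos mult_nonneg_nonneg less_imp_le[OF u0] u0 v(1)) auto
  qed
  have "\<alpha> * (\<Sum>a\<in>UNIV. u a * v a) = (\<Sum>a\<in>UNIV. (\<alpha> * u a) * v a)" by (simp add: sum_distrib_left algebra_simps)
  also have "\<dots> \<le> (\<Sum>a\<in>UNIV. (\<Sum>b\<in>UNIV. u b * A b a) * v a)"
    by (intro sum_mono mult_right_mono lo v)
  also have "\<dots> = (\<Sum>b\<in>UNIV. u b * (\<Sum>a\<in>UNIV. A b a * v a))"
    unfolding sum_distrib_left sum_distrib_right by (subst sum.swap) (simp add: mult.assoc)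
  also have "\<dots> = \<mu> * (\<Sum>a\<in>UNIV. u a * v a)" by (simp only: v(4)) (simp add: sum_distrib_left mult.left_commute)
  finally have "\<alpha> \<le> \<mu>" using pos by simp
  also have "\<mu> \<le> pf_eig A" unfolding pf_eig_def
    by (rule cSup_upper) (use ev v(3) bd in \<open>auto intro!: bdd_aboveI[of _ \<beta>] exI[of _ "complex_of_real \<mu>"]\<close>)
  finally show "\<alpha> \<le> pf_eig A" .
  show "pf_eig A \<le> \<beta>" unfolding pf_eig_def
    by (rule cSup_least) (use ev bd in auto)
qed

section \<open>Path sums of tilted Markov chains\<close>

lemma markov_prob_snoc:
  assumes "xs \<noteq> []"
  shows "markov_prob p A (xs @ [b]) = markov_prob p A xs * A b (last xs)"
proof -
  have L: "length xs \<ge> 1" using assms by (cases xs) auto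
  have "(\<Prod>i\<in>{1..<length xs}. A ((xs @ [b]) ! i) ((xs @ [b]) ! (i - 1)))
      = (\<Prod>i\<in>{1..<length xs}. A (xs ! i) (xs ! (i - 1)))"
    by (rule prod.cong) (auto simp: nth_append)
  moreover have "(xs @ [b]) ! (length xs - 1) = last xs"
    using assms by (simp add: nth_append last_conv_nth)
  ultimately show ?thesis
    using assms L by (simp add: markov_prob_def prod.atLeastLessThan_Suc hd_append)
qed

lemma markov_prob_single [simp]: "markov_prob p A [b] = p b"
  by (simp add: markov_prob_def)

lemma markov_prob_nonneg:
  assumes "\<And>a. p a \<ge> 0" "\<And>a b. A a b \<ge> 0"
  shows "markov_prob p A xs \<ge> 0"
  using assms by (auto simp: markov_prob_def intro!: mult_nonneg_nonneg prod_nonneg)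

lemma finite_words [simp]: "finite {xs :: 'a::finite list. length xs = n}"
  using finite_lists_length_eq[of "UNIV :: 'a set" n] by simp

lemma card_words: "card {xs :: 'a::finite list. length xs = n} = CARD('a) ^ n"
  using card_lists_length_eq[of "UNIV :: 'a set" n] by simp

lemma sum_words_snoc:
  "(\<Sum>xs | length xs = Suc n. G (xs :: 'a::finite list)) = (\<Sum>xs | length xs = n. \<Sum>b\<in>UNIV. G (xs @ [b]))"
  unfolding sum.cartesian_product
proof (rule sum.reindex_bij_witness[of _ "\<lambda>(xs, b). xs @ [b]" "\<lambda>xs. (butlast xs, last xs)"])
  fix xs :: "'a list" assume "xs \<in> {xs. length xs = Suc n}"
  hence "xs \<noteq> []" "length xs = Suc n" by auto
  thus "(case (butlast xs, last xs) of (xs, b) \<Rightarrow> xs @ [b]) = xs"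
    "(butlast xs, last xs) \<in> {xs. length xs = n} \<times> UNIV"
    "(case (butlast xs, last xs) of (xs, b) \<Rightarrow> G (xs @ [b])) = G xs" by auto
qed auto

lemma sum_words_one: "(\<Sum>xs | length xs = Suc 0. G (xs :: 'a::finite list)) = (\<Sum>b\<in>UNIV. G [b])"
  by (subst sum_words_snoc) simp

text \<open>The weight \<open>u (last xs)\<close> makes the induction close: summing out the last
  letter turns it into \<open>u A\<close> at the preceding letter, that is, into a factor \<alpha>
  or \<beta> and the same weight. A word of length \<open>Suc n\<close> has n transitions.\<close>

lemma sum_markov_prob_last_bounds:
  fixes p u :: "'a::finite \<Rightarrow> real"
  assumes p0: "\<And>a. p a \<ge> 0" and A0: "\<And>a b. A a b \<ge> 0" and \<alpha>: "\<alpha> \<ge> 0" and \<beta>: "\<beta> \<ge> 0"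
    and lo: "\<And>a. \<alpha> * u a \<le> (\<Sum>b\<in>UNIV. u b * A b a)"
    and up: "\<And>a. (\<Sum>b\<in>UNIV. u b * A b a) \<le> \<beta> * u a"
  shows "\<alpha> ^ n * (\<Sum>a\<in>UNIV. u a * p a) \<le> (\<Sum>xs | length xs = Suc n. u (last xs) * markov_prob p A xs)"
    and "(\<Sum>xs | length xs = Suc n. u (last xs) * markov_prob p A xs) \<le> \<beta> ^ n * (\<Sum>a\<in>UNIV. u a * p a)"
proof (induction n)
  case 0
  { case 1 show ?case by (simp add: sum_words_one) }
  { case 2 show ?case by (simp add: sum_words_one) }
next
  case (Suc n)
  have eq: "(\<Sum>xs | length xs = Suc (Suc n). u (last xs) * markov_prob p A xs) =
        (\<Sum>xs | length xs = Suc n. (\<Sum>b\<in>UNIV. u b * A b (last xs)) * markov_prob p A xs)"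
    unfolding sum_words_snoc[of _ "Suc n"] sum_distrib_right
    by (intro sum.cong refl) (auto simp: markov_prob_snoc simp flip: length_greater_0_conv)
  note nn = markov_prob_nonneg[of p A, OF p0 A0]
  { case 1
    have "\<alpha> ^ Suc n * (\<Sum>a\<in>UNIV. u a * p a) \<le> \<alpha> * (\<Sum>xs | length xs = Suc n. u (last xs) * markov_prob p A xs)"
      using mult_left_mono[OF Suc.IH(1) \<alpha>] by (simp add: mult.assoc)
    also have "\<dots> = (\<Sum>xs | length xs = Suc n. (\<alpha> * u (last xs)) * markov_prob p A xs)"
      by (simp add: sum_distrib_left mult.assoc)
    also have "\<dots> \<le> (\<Sum>xs | length xs = Suc n. (\<Sum>b\<in>UNIV. u b * A b (last xs)) * markov_prob p A xs)"
      by (intro sum_mono mult_right_mono lo nn)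
    finally show ?case unfolding eq . }
  { case 2
    have "(\<Sum>xs | length xs = Suc n. (\<Sum>b\<in>UNIV. u b * A b (last xs)) * markov_prob p A xs)
        \<le> (\<Sum>xs | length xs = Suc n. (\<beta> * u (last xs)) * markov_prob p A xs)"
      by (intro sum_mono mult_right_mono up nn)
    also have "\<dots> = \<beta> * (\<Sum>xs | length xs = Suc n. u (last xs) * markov_prob p A xs)"
      by (simp add: sum_distrib_left mult.assoc)
    also have "\<dots> \<le> \<beta> ^ Suc n * (\<Sum>a\<in>UNIV. u a * p a)"
      using mult_left_mono[OF Suc.IH(2) \<beta>] by (simp add: mult.assoc)
    finally show ?case unfolding eq . }
qed

text \<open>Removing the weight \<open>u\<close> costs a factor 2, and the weighted initial mass
  lies between 1/4 and 4, whatever \<open>n\<close> is. \<open>p\<close> need not have mass 1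
  because the initial law gets tilted as well.\<close>

lemma ln_sum_markov_prob_bounds:
  fixes p u :: "'a::finite \<Rightarrow> real"
  assumes p0: "\<And>a. p a \<ge> 0" and A0: "\<And>a b. A a b \<ge> 0" and u: "\<And>a. 1/2 \<le> u a" "\<And>a. u a \<le> 2"
    and lo: "\<And>a. exp x * u a \<le> (\<Sum>b\<in>UNIV. u b * A b a)"
    and up: "\<And>a. (\<Sum>b\<in>UNIV. u b * A b a) \<le> exp y * u a"
    and p: "1/2 \<le> (\<Sum>a\<in>UNIV. p a)" "(\<Sum>a\<in>UNIV. p a) \<le> 2"
  shows "0 < (\<Sum>xs | length xs = Suc n. markov_prob p A xs)"
    and "real n * x - 7 \<le> ln (\<Sum>xs | length xs = Suc n. markov_prob p A xs)"
    and "ln (\<Sum>xs | length xs = Suc n. markov_prob p A xs) \<le> real n * y + 7"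
proof -
  let ?S = "\<Sum>xs | length xs = Suc n. markov_prob p A xs"
  let ?U = "\<Sum>xs | length xs = Suc n. u (last xs) * markov_prob p A xs"
  note nn = markov_prob_nonneg[of p A, OF p0 A0]
  note b = sum_markov_prob_last_bounds[where u = u and A = A and p = p, OF p0 A0 exp_ge_zero exp_ge_zero lo up]
  have "?U \<le> (\<Sum>xs | length xs = Suc n. 2 * markov_prob p A xs)"
    by (intro sum_mono mult_right_mono u nn)
  hence U1: "?U \<le> 2 * ?S" by (simp add: sum_distrib_left)
  have "?U \<ge> (\<Sum>xs | length xs = Suc n. 1/2 * markov_prob p A xs)"
    by (intro sum_mono mult_right_mono u nn)
  hence U2: "?U \<ge> 1/2 * ?S" by (simp only: sum_distrib_left)
  have "(\<Sum>a\<in>UNIV. u a * p a) \<le> (\<Sum>a\<in>UNIV. 2 * p a)" by (intro sum_mono mult_right_mono u p0)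
  hence P1: "(\<Sum>a\<in>UNIV. u a * p a) \<le> 4" using p by (simp add: sum_distrib_left[symmetric])
  have "(\<Sum>a\<in>UNIV. u a * p a) \<ge> (\<Sum>a\<in>UNIV. 1/2 * p a)" by (intro sum_mono mult_right_mono u p0)
  hence P2: "(\<Sum>a\<in>UNIV. u a * p a) \<ge> 1/4" using p by (simp only: sum_distrib_left[symmetric])
  have "exp x ^ n * (1/4) \<le> exp x ^ n * (\<Sum>a\<in>UNIV. u a * p a)" by (intro mult_left_mono P2) auto
  also note b(1)
  also note U1
  finally have l: "exp (real n * x) * (1/8) \<le> ?S" by (simp add: exp_of_nat_mult)
  have "1/2 * ?S \<le> exp y ^ n * (\<Sum>a\<in>UNIV. u a * p a)" using U2 b(2) by (rule order_trans)
  also have "\<dots> \<le> exp y ^ n * 4" by (intro mult_left_mono P1) auto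
  finally have r: "?S \<le> exp (real n * y) * 8" by (simp add: exp_of_nat_mult)
  have "0 < exp (real n * x) * (1/8)" by simp
  thus S: "0 < ?S" using l by (rule less_le_trans)
  \<comment> \<open>8 = 2 * 4 collects the two factors; 7 is the crude bound from ln x \<le> x -
    1.\<close>
  have e: "ln (8::real) \<le> 7" using ln_le_minus_one[of 8] by simp
  have "ln (exp (real n * x) * (1/8)) \<le> ln ?S" using l S by (subst ln_le_cancel_iff) auto
  thus "real n * x - 7 \<le> ln ?S" using e by (simp add: ln_mult ln_div)
  have "ln ?S \<le> ln (exp (real n * y) * 8)" using r S by (subst ln_le_cancel_iff) auto
  thus "ln ?S \<le> real n * y + 7" using e by (simp add: ln_mult)
qed

text \<open>One pair \<open>H\<close>, \<open>v\<close> serves both the eigenvalue limits, which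
  define entropy and variance, and the path sums. The neighbourhood of 0 is fixed before
  \<open>n\<close>, so that \<theta> may later depend on \<open>n\<close>. The initial law and its
  tilt influence only the bounded term.\<close>

lemma tilted_chain_asymptotics:
  fixes W f :: "'a::finite \<Rightarrow> 'a \<Rightarrow> real"
  assumes st: "stochastic W" and ir: "irreducible_mc W"
  obtains H v where
    "((\<lambda>\<theta>. ln (pf_eig (\<lambda>b a. W b a * exp (\<theta> * f b a))) / \<theta>) \<longlongrightarrow> H) (at 0)"
    "((\<lambda>\<theta>. 2 * (ln (pf_eig (\<lambda>b a. W b a * exp (\<theta> * f b a))) / \<theta> - H) / \<theta>) \<longlongrightarrow> v) (at 0)"
    "\<And>\<epsilon> p f0. \<epsilon> > 0 \<Longrightarrow> is_pmf p \<Longrightarrow> \<forall>\<^sub>F \<theta> in at 0. \<forall>n\<ge>1.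
       (\<Sum>xs | length xs = n. markov_prob (\<lambda>a. p a * exp (\<theta> * f0 a)) (\<lambda>b a. W b a * exp (\<theta> * f b a)) xs) > 0 \<and>
       \<bar>ln (\<Sum>xs | length xs = n. markov_prob (\<lambda>a. p a * exp (\<theta> * f0 a)) (\<lambda>b a. W b a * exp (\<theta> * f b a)) xs)
          - real n * (H * \<theta> + v * \<theta>\<^sup>2 / 2)\<bar> \<le> real n * (\<epsilon> * \<theta>\<^sup>2) + 8"
proof -
  have W0: "W b a \<ge> 0" and W1: "(\<Sum>b\<in>UNIV. W b a) = 1" for a b
    using st by (auto simp: stochastic_def)
  define A where "A = (\<lambda>\<theta> b a. W b a * exp (\<theta> * f b a))"
  have A0: "A \<theta> b a \<ge> 0" for \<theta> a b using W0 by (simp add: A_def)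
  have Apos: "(\<Sum>b\<in>UNIV. A \<theta> b a) > 0" for \<theta> a
  proof -
    have "\<exists>b. W b a \<noteq> 0" using W1[of a] by (metis sum.neutral zero_neq_one)
    then obtain b where "W b a > 0" using W0 by (metis order_le_less)
    thus ?thesis by (intro sum_pos2[of _ b] A0) (auto simp: A_def)
  qed
  obtain H v where ap: "\<And>\<epsilon>. \<epsilon> > 0 \<Longrightarrow> \<forall>\<^sub>F \<theta> in at 0. \<exists>u. \<forall>a. 1/2 \<le> u a \<and> u a \<le> 2 \<and>
      exp (H * \<theta> + v * \<theta>\<^sup>2 / 2 - \<epsilon> * \<theta>\<^sup>2) * u a \<le> (\<Sum>b\<in>UNIV. u b * A \<theta> b a) \<and>
      (\<Sum>b\<in>UNIV. u b * A \<theta> b a) \<le> exp (H * \<theta> + v * \<theta>\<^sup>2 / 2 + \<epsilon> * \<theta>\<^sup>2) * u a"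
    using tilted_approx_eigenvector[OF st ir, of f] unfolding A_def by blast
  define lam where "lam = (\<lambda>\<theta>. ln (pf_eig (A \<theta>)))"
  have lam: "\<forall>\<^sub>F \<theta> in at 0. \<bar>lam \<theta> - H * \<theta> - v * \<theta>\<^sup>2 / 2\<bar> \<le> \<epsilon> * \<theta>\<^sup>2" if "\<epsilon> > 0" for \<epsilon>
    using ap[OF that]
  proof eventually_elim
    case (elim \<theta>)
    then obtain u where u: "1/2 \<le> u a" "exp (H * \<theta> + v * \<theta>\<^sup>2 / 2 - \<epsilon> * \<theta>\<^sup>2) * u a \<le> (\<Sum>b\<in>UNIV. u b * A \<theta> b a)"
      "(\<Sum>b\<in>UNIV. u b * A \<theta> b a) \<le> exp (H * \<theta> + v * \<theta>\<^sup>2 / 2 + \<epsilon> * \<theta>\<^sup>2) * u a" for a by blast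
    have u0: "u a > 0" for a using u(1)[of a] by linarith
    note cw = pf_eig_Collatz_Wielandt[of "A \<theta>" u, OF A0 Apos u0 u(2,3)]
    have "pf_eig (A \<theta>) > 0" using cw(1) by (rule less_le_trans[OF exp_gt_zero])
    hence "H * \<theta> + v * \<theta>\<^sup>2 / 2 - \<epsilon> * \<theta>\<^sup>2 \<le> lam \<theta>" "lam \<theta> \<le> H * \<theta> + v * \<theta>\<^sup>2 / 2 + \<epsilon> * \<theta>\<^sup>2"
      using cw by (auto simp: lam_def ln_ge_iff intro: ln_le_cancel_iff[THEN iffD2, of _ "exp _", simplified])
    thus ?case by (simp add: abs_le_iff)
  qed
  have nz: "\<forall>\<^sub>F \<theta>::real in at 0. \<theta> \<noteq> 0" by (simp add: eventually_at_filter)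
  have lim2: "((\<lambda>\<theta>. (lam \<theta> - H * \<theta>) / \<theta>\<^sup>2) \<longlongrightarrow> v / 2) (at 0)"
  proof (rule tendstoI)
    fix e :: real assume "e > 0"
    hence "e / 2 > 0" by simp
    from lam[OF this] nz show "\<forall>\<^sub>F \<theta> in at 0. dist ((lam \<theta> - H * \<theta>) / \<theta>\<^sup>2) (v / 2) < e"
    proof eventually_elim
      case (elim \<theta>)
      have "dist ((lam \<theta> - H * \<theta>) / \<theta>\<^sup>2) (v / 2) = \<bar>(lam \<theta> - H * \<theta> - v * \<theta>\<^sup>2 / 2) / \<theta>\<^sup>2\<bar>"
        using elim(2) by (simp add: dist_real_def diff_divide_distrib)
      also have "\<dots> \<le> e / 2" using elim by (simp add: abs_divide pos_divide_le_eq)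
      finally show ?case using \<open>e > 0\<close> by linarith
    qed
  qed
  have "((\<lambda>\<theta>. (lam \<theta> - H * \<theta>) / \<theta>\<^sup>2 * \<theta> + H) \<longlongrightarrow> v / 2 * 0 + H) (at 0)"
    by (intro tendsto_intros lim2)
  moreover have "\<forall>\<^sub>F \<theta> in at 0. (lam \<theta> - H * \<theta>) / \<theta>\<^sup>2 * \<theta> + H = lam \<theta> / \<theta>"
    unfolding eventually_at_filter by (rule always_eventually) (auto simp: power2_eq_square field_simps)
  ultimately have "((\<lambda>\<theta>. lam \<theta> / \<theta>) \<longlongrightarrow> v / 2 * 0 + H) (at 0)" by (rule Lim_transform_eventually)
  hence 1: "((\<lambda>\<theta>. lam \<theta> / \<theta>) \<longlongrightarrow> H) (at 0)" by simp
  have "((\<lambda>\<theta>. 2 * ((lam \<theta> - H * \<theta>) / \<theta>\<^sup>2)) \<longlongrightarrow> 2 * (v / 2)) (at 0)"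
    by (intro tendsto_intros lim2)
  moreover have "\<forall>\<^sub>F \<theta> in at 0. 2 * ((lam \<theta> - H * \<theta>) / \<theta>\<^sup>2) = 2 * (lam \<theta> / \<theta> - H) / \<theta>"
    unfolding eventually_at_filter by (rule always_eventually) (auto simp: power2_eq_square field_simps)
  ultimately have "((\<lambda>\<theta>. 2 * (lam \<theta> / \<theta> - H) / \<theta>) \<longlongrightarrow> 2 * (v / 2)) (at 0)" by (rule Lim_transform_eventually)
  hence 2: "((\<lambda>\<theta>. 2 * (lam \<theta> / \<theta> - H) / \<theta>) \<longlongrightarrow> v) (at 0)" by simp
  have 3: "\<forall>\<^sub>F \<theta> in at 0. \<forall>n\<ge>1.
       (\<Sum>xs | length xs = n. markov_prob (\<lambda>a. p a * exp (\<theta> * f0 a)) (A \<theta>) xs) > 0 \<and>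
       \<bar>ln (\<Sum>xs | length xs = n. markov_prob (\<lambda>a. p a * exp (\<theta> * f0 a)) (A \<theta>) xs)
          - real n * (H * \<theta> + v * \<theta>\<^sup>2 / 2)\<bar> \<le> real n * (\<epsilon> * \<theta>\<^sup>2) + 8"
    if e: "\<epsilon> > 0" and p: "is_pmf p" for \<epsilon> p f0
  proof -
    have "((\<lambda>\<theta>. \<Sum>a\<in>UNIV. p a * exp (\<theta> * f0 a)) \<longlongrightarrow> (\<Sum>a\<in>UNIV. p a * exp (0 * f0 a))) (at 0)"
      by (intro tendsto_intros)
    hence "((\<lambda>\<theta>. \<Sum>a\<in>UNIV. p a * exp (\<theta> * f0 a)) \<longlongrightarrow> 1) (at 0)"
      using p by (simp add: is_pmf_def)
    hence "\<forall>\<^sub>F \<theta> in at 0. dist (\<Sum>a\<in>UNIV. p a * exp (\<theta> * f0 a)) 1 < 1/2" by (rule tendstoD) simp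
    \<comment> \<open>With an exponent per transition below 1 in modulus, passing from n - 1
      transitions to n costs at most 1, so the constant 7 becomes 8.\<close>
    moreover have "\<forall>\<^sub>F \<theta> in at 0. dist (H * \<theta> + v * \<theta>\<^sup>2 / 2 - \<epsilon> * \<theta>\<^sup>2) 0 < 1"
    proof (rule tendstoD)
      have "((\<lambda>\<theta>. H * \<theta> + v * \<theta>\<^sup>2 / 2 - \<epsilon> * \<theta>\<^sup>2) \<longlongrightarrow> H * 0 + v * 0\<^sup>2 / 2 - \<epsilon> * 0\<^sup>2) (at 0)"
        by (intro tendsto_intros) auto
      thus "((\<lambda>\<theta>. H * \<theta> + v * \<theta>\<^sup>2 / 2 - \<epsilon> * \<theta>\<^sup>2) \<longlongrightarrow> 0) (at 0)" by simp
    qed auto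
    moreover have "\<forall>\<^sub>F \<theta> in at 0. dist (H * \<theta> + v * \<theta>\<^sup>2 / 2 + \<epsilon> * \<theta>\<^sup>2) 0 < 1"
    proof (rule tendstoD)
      have "((\<lambda>\<theta>. H * \<theta> + v * \<theta>\<^sup>2 / 2 + \<epsilon> * \<theta>\<^sup>2) \<longlongrightarrow> H * 0 + v * 0\<^sup>2 / 2 + \<epsilon> * 0\<^sup>2) (at 0)"
        by (intro tendsto_intros) auto
      thus "((\<lambda>\<theta>. H * \<theta> + v * \<theta>\<^sup>2 / 2 + \<epsilon> * \<theta>\<^sup>2) \<longlongrightarrow> 0) (at 0)" by simp
    qed auto
    ultimately show ?thesis using ap[OF e]
    proof eventually_elim
      case (elim \<theta>)
      then obtain u where u: "1/2 \<le> u a" "u a \<le> 2" "exp (H * \<theta> + v * \<theta>\<^sup>2 / 2 - \<epsilon> * \<theta>\<^sup>2) * u a \<le> (\<Sum>b\<in>UNIV. u b * A \<theta> b a)"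
        "(\<Sum>b\<in>UNIV. u b * A \<theta> b a) \<le> exp (H * \<theta> + v * \<theta>\<^sup>2 / 2 + \<epsilon> * \<theta>\<^sup>2) * u a" for a by blast
      have p0: "p a * exp (\<theta> * f0 a) \<ge> 0" for a using p by (simp add: is_pmf_def)
      have ps: "1/2 \<le> (\<Sum>a\<in>UNIV. p a * exp (\<theta> * f0 a))" "(\<Sum>a\<in>UNIV. p a * exp (\<theta> * f0 a)) \<le> 2"
        using elim(1) unfolding dist_real_def abs_less_iff by linarith+
      note b = ln_sum_markov_prob_bounds[where p = "\<lambda>a. p a * exp (\<theta> * f0 a)" and A = "A \<theta>" and u = u, OF p0 A0 u ps]
      have aux: "\<bar>L - (1 + m) * a\<bar> \<le> (1 + m) * E + 8"
        if "m * (a - E) - 7 \<le> L" "L \<le> m * (a + E) + 7" "\<bar>a - E\<bar> < 1" "\<bar>a + E\<bar> < 1" for m a E L :: real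
        using that by (auto simp: algebra_simps abs_le_iff abs_less_iff)
      show ?case
      proof (intro allI impI)
        fix n :: nat assume "n \<ge> 1"
        then obtain m where n: "n = Suc m" by (cases n) auto
        show "(\<Sum>xs | length xs = n. markov_prob (\<lambda>a. p a * exp (\<theta> * f0 a)) (A \<theta>) xs) > 0 \<and>
           \<bar>ln (\<Sum>xs | length xs = n. markov_prob (\<lambda>a. p a * exp (\<theta> * f0 a)) (A \<theta>) xs)
            - real n * (H * \<theta> + v * \<theta>\<^sup>2 / 2)\<bar> \<le> real n * (\<epsilon> * \<theta>\<^sup>2) + 8"
          using b(1)[of m] aux[OF b(2,3)[of m]] elim(2,3) unfolding n dist_real_def of_nat_Suc by simp
      qed
    qed
  qed
  show ?thesis
    by (rule that[of H v]) (use 1 2 3 in \<open>simp_all add: lam_def A_def\<close>)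
qed

section \<open>Coding bounds\<close>

abbreviation shift :: "('x::ab_group_add \<times> 'z) list \<Rightarrow> 'x list \<Rightarrow> ('x \<times> 'z) list" where
  "shift ys u \<equiv> map2 (\<lambda>(x, z) xt. (x - xt, z)) ys u"

abbreviation unshift :: "('x::ab_group_add \<times> 'z) list \<Rightarrow> 'x list \<Rightarrow> ('x \<times> 'z) list" where
  "unshift ys u \<equiv> map2 (\<lambda>(x, z) xt. (x + xt, z)) ys u"

lemma shift_unshift: "length ys = length u \<Longrightarrow> shift (unshift ys u) u = ys"
  by (rule nth_equalityI) (auto split: prod.splits)

lemma unshift_shift: "length ys = length u \<Longrightarrow> unshift (shift ys u) u = ys"
  by (rule nth_equalityI) (auto split: prod.splits)

lemma map_snd_shift: "length ys = length u \<Longrightarrow> map snd (shift ys u) = map snd ys"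
  by (rule nth_equalityI) (auto split: prod.splits)

lemma map_snd_unshift: "length ys = length u \<Longrightarrow> map snd (unshift ys u) = map snd ys"
  by (rule nth_equalityI) (auto split: prod.splits)

lemma sum_shift:
  fixes G :: "('x::{finite,ab_group_add} \<times> 'z::finite) list \<Rightarrow> ('x \<times> 'z) list \<Rightarrow> real"
  assumes "length u = n"
  shows "(\<Sum>ys | length ys = n. G (shift ys u) ys) = (\<Sum>xz | length xz = n. G xz (unshift xz u))"
  by (rule sum.reindex_bij_witness[of _ "\<lambda>xz. unshift xz u" "\<lambda>ys. shift ys u"])
     (use assms in \<open>auto simp: shift_unshift unshift_shift\<close>)

lemma shift_zip: "length ys = length u \<Longrightarrow> shift ys u = zip (map2 (-) (map fst ys) u) (map snd ys)"
  by (rule nth_equalityI) (auto split: prod.splits)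

text \<open>For a fixed output the X-part of the noise is x - u, an involution in the codeword u. A
  uniform codeword thus makes the X-part uniform and leaves the Z-part in place.\<close>

lemma sum_shift_arg:
  fixes G :: "('x::{finite,ab_group_add} \<times> 'z::finite) list \<Rightarrow> real"
  assumes "length ys = n"
  shows "(\<Sum>u | length u = n. G (shift ys u)) = (\<Sum>xs | length xs = n. G (zip xs (map snd ys)))"
proof (rule sum.reindex_bij_witness[of _ "\<lambda>u. map2 (-) (map fst ys) u" "\<lambda>u. map2 (-) (map fst ys) u"])
  fix u :: "'x list" assume "u \<in> {u. length u = n}"
  hence u: "length u = n" by simp
  show "map2 (-) (map fst ys) (map2 (-) (map fst ys) u) = u"
    by (rule nth_equalityI) (use u assms in auto)
  thus "map2 (-) (map fst ys) (map2 (-) (map fst ys) u) = u" .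
  show "G (zip (map2 (-) (map fst ys) u) (map snd ys)) = G (shift ys u)"
    using u assms by (simp add: shift_zip)
qed (use assms in auto)

lemma sum_words_zip:
  fixes G :: "('x::finite \<times> 'z::finite) list \<Rightarrow> real"
  shows "(\<Sum>ys | length ys = n. G ys) = (\<Sum>zs | length zs = n. \<Sum>xs | length xs = n. G (zip xs zs))"
  unfolding sum.cartesian_product
  by (rule sum.reindex_bij_witness[of _ "\<lambda>(zs, xs). zip xs zs" "\<lambda>ys. (map snd ys, map fst ys)"])
     (auto simp: zip_map_fst_snd)

text \<open>Induction from the right: once the last X-letter is summed out, Assumption 1 leaves a
  factor that no longer involves the preceding X-letter.\<close>

lemma sum_markov_prob_zip:
  fixes P :: "('x::{finite,ab_group_add} \<times> 'z::finite) \<Rightarrow> real"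
  assumes a1: "assumption1 W"
  shows "(\<Sum>xs | length xs = length zs. markov_prob P W (zip xs zs)) = markov_prob (\<lambda>z. \<Sum>x\<in>UNIV. P (x, z)) (WcZ W) zs"
proof (induction zs rule: rev_induct)
  case Nil
  show ?case by (simp add: markov_prob_def)
next
  case (snoc z zs)
  show ?case
  proof (cases "zs = []")
    case True
    thus ?thesis by (simp add: sum_words_one)
  next
    case False
    have W: "(\<Sum>b\<in>UNIV. W (b, z) (x, z')) = WcZ W z z'" for x z'
      using a1 unfolding assumption1_def WcZ_def by blast
    have "(\<Sum>xs | length xs = length (zs @ [z]). markov_prob P W (zip xs (zs @ [z])))
        = (\<Sum>xs | length xs = length zs. \<Sum>b\<in>UNIV. markov_prob P W (zip (xs @ [b]) (zs @ [z])))"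
      by (simp only: length_append length_Cons list.size add_Suc_right add_0_right sum_words_snoc)
    also have "\<dots> = (\<Sum>xs | length xs = length zs. markov_prob P W (zip xs zs) * WcZ W z (last zs))"
    proof (rule sum.cong)
      fix xs :: "'x list" assume "xs \<in> {xs. length xs = length zs}"
      hence xs: "length xs = length zs" "xs \<noteq> []" "zip xs zs \<noteq> []" using False by (auto simp: zip_eq_Nil_iff)
      have "last (zip xs zs) = (last xs, last zs)" using xs False by (simp add: last_zip)
      thus "(\<Sum>b\<in>UNIV. markov_prob P W (zip (xs @ [b]) (zs @ [z]))) = markov_prob P W (zip xs zs) * WcZ W z (last zs)"
        using xs by (simp add: markov_prob_snoc W flip: sum_distrib_left)
    qed simp
    also have "\<dots> = markov_prob (\<lambda>z. \<Sum>x\<in>UNIV. P (x, z)) (WcZ W) zs * WcZ W z (last zs)"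
      using snoc by (simp flip: sum_distrib_right)
    finally show ?thesis using False by (simp add: markov_prob_snoc)
  qed
qed

lemma sum_markov_prob_eq_1:
  fixes p :: "'a::finite \<Rightarrow> real"
  assumes "is_pmf p" "stochastic W"
  shows "(\<Sum>xs | length xs = n. markov_prob p W xs) = 1"
proof (cases n)
  case 0
  thus ?thesis by (simp add: markov_prob_def)
next
  case (Suc m)
  have "(\<Sum>xs | length xs = Suc m. markov_prob p W xs) = 1"
  proof (induction m)
    case 0
    show ?case using assms by (simp add: sum_words_one is_pmf_def)
  next
    case (Suc m)
    have "(\<Sum>xs | length xs = Suc (Suc m). markov_prob p W xs) = (\<Sum>xs | length xs = Suc m. markov_prob p W xs)"
      unfolding sum_words_snoc[of _ "Suc m"]
    proof (rule sum.cong)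
      fix xs :: "'a list" assume "xs \<in> {xs. length xs = Suc m}"
      hence "xs \<noteq> []" by auto
      thus "(\<Sum>b\<in>UNIV. markov_prob p W (xs @ [b])) = markov_prob p W xs"
        using assms by (simp add: markov_prob_snoc stochastic_def flip: sum_distrib_left)
    qed simp
    thus ?case using Suc by simp
  qed
  thus ?thesis using Suc by simp
qed

text \<open>This replaces the independence of random codewords: one coordinate of a uniform code may
  be redrawn, with all others kept, without changing averages.\<close>

lemma sum_resample:
  fixes G :: "('i \<Rightarrow> 's) \<Rightarrow> real"
  assumes j: "j \<in> I"
  shows "(\<Sum>e\<in>PiE I (\<lambda>_. S). \<Sum>u\<in>S. G (e(j := u))) = real (card S) * (\<Sum>e\<in>PiE I (\<lambda>_. S). G e)"
proof -
  have "(\<Sum>(e, u)\<in>PiE I (\<lambda>_. S) \<times> S. G (e(j := u))) = (\<Sum>(e, u)\<in>PiE I (\<lambda>_. S) \<times> S. G e)"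
    \<comment> \<open>exchanging the coordinate \<open>j\<close> of \<open>e\<close> with \<open>u\<close> is an involution\<close>
    by (rule sum.reindex_bij_witness[of _ "\<lambda>(e, u). (e(j := u), e j)" "\<lambda>(e, u). (e(j := u), e j)"])
       (use j in \<open>auto simp: PiE_iff extensional_def\<close>)
  thus ?thesis by (simp add: sum.cartesian_product[symmetric] sum_distrib_left)
qed

text \<open>Uniformly random codewords with maximum a posteriori decoding: a competing message beats the
  true one with conditional probability at most \<open>P ms' Q z / (P ms Pc xz |X|^n)\<close>, by Markov's inequality
  for the uniformly distributed difference.\<close>

lemma random_coding_bound:
  fixes P :: "'m::finite list \<Rightarrow> real" and Pc :: "('x::{finite,ab_group_add} \<times> 'z::finite) list \<Rightarrow> real"
    and Q :: "'z list \<Rightarrow> real"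
  assumes P0: "\<And>ms. P ms \<ge> 0" and P1: "(\<Sum>ms | length ms = k. P ms) = 1"
    and Pc0: "\<And>ys. Pc ys \<ge> 0"
    and Q: "\<And>zs. length zs = n \<Longrightarrow> (\<Sum>xs | length xs = n. Pc (zip xs zs)) = Q zs"
  shows "\<exists>e d. (\<forall>ms. length ms = k \<longrightarrow> length (e ms) = n) \<and>
    (\<Sum>ms | length ms = k. P ms * (\<Sum>ys | length ys = n \<and> d ys \<noteq> ms. Pc (shift ys (e ms)))) \<le>
    (\<Sum>ms | length ms = k. \<Sum>xz | length xz = n. P ms * Pc xz *
        min 1 (Q (map snd xz) / (P ms * Pc xz * real CARD('x) ^ n)))"
proof -
  define Ms where "Ms = {ms::'m list. length ms = k}"
  define Xs where "Xs = {u::'x list. length u = n}"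
  define Ys where "Ys = {ys::('x \<times> 'z) list. length ys = n}"
  define E where "E = PiE Ms (\<lambda>_. Xs)"
  define N where "N = real CARD('x) ^ n"
  have fin: "finite Ms" "finite Xs" "finite Ys" by (auto simp: Ms_def Xs_def Ys_def)
  have finE: "finite E" unfolding E_def by (intro finite_PiE fin)
  have N: "N > 0" "real (card Xs) = N" by (auto simp: N_def Xs_def card_words)
  have "replicate n 0 \<in> Xs" by (simp add: Xs_def)
  hence "E \<noteq> {}" by (auto simp: E_def PiE_eq_empty_iff)
  hence cE: "real (card E) > 0" using finE by (simp add: card_gt_0_iff)
  have "replicate k undefined \<in> Ms" by (simp add: Ms_def)
  hence Ms_ne: "Ms \<noteq> {}" by auto
  \<comment> \<open>The decoder is chosen for all codes \<open>e\<close> at once because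
    \<open>e\<close> is still to be averaged over.\<close>
  have "\<exists>dec. \<forall>e ys. dec e ys \<in> Ms \<and>
      (\<forall>ms\<in>Ms. P ms * Pc (shift ys (e ms)) \<le> P (dec e ys) * Pc (shift ys (e (dec e ys))))"
  proof (rule choice, rule allI, rule choice, rule allI)
    fix e :: "'m list \<Rightarrow> 'x list" and ys :: "('x \<times> 'z) list"
    let ?g = "\<lambda>ms. P ms * Pc (shift ys (e ms))"
    have "Max (?g ` Ms) \<in> ?g ` Ms" by (rule Max_in) (use fin Ms_ne in auto)
    then obtain m where m: "m \<in> Ms" "Max (?g ` Ms) = ?g m" by blast
    have "?g ms \<le> ?g m" if "ms \<in> Ms" for ms
      using Max_ge[of "?g ` Ms" "?g ms"] fin that m(2) by simp
    thus "\<exists>m. m \<in> Ms \<and> (\<forall>ms\<in>Ms. ?g ms \<le> ?g m)"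
      using m(1) by blast
  qed
  then obtain dec where dec: "\<And>e ys. dec e ys \<in> Ms"
    "\<And>e ys ms. ms \<in> Ms \<Longrightarrow> P ms * Pc (shift ys (e ms)) \<le> P (dec e ys) * Pc (shift ys (e (dec e ys)))"
    by blast
  define err where "err = (\<lambda>e. \<Sum>ms\<in>Ms. P ms * (\<Sum>ys | length ys = n \<and> dec e ys \<noteq> ms. Pc (shift ys (e ms))))"
  \<comment> \<open>Ties count as errors, so \<open>B\<close> covers every decoding error whichever
    maximiser \<open>dec\<close> picks.\<close>
  define B where "B = (\<lambda>e ms xz. \<exists>ms'\<in>Ms - {ms}. P ms * Pc xz \<le> P ms' * Pc (shift (unshift xz (e ms)) (e ms')))"
  define T where "T = (\<Sum>ms\<in>Ms. \<Sum>xz\<in>Ys. P ms * Pc xz * min 1 (Q (map snd xz) / (P ms * Pc xz * N)))"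
  have err_le: "err e \<le> (\<Sum>ms\<in>Ms. \<Sum>xz\<in>Ys. P ms * Pc xz * of_bool (B e ms xz))" if e: "e \<in> E" for e
    unfolding err_def
  proof (rule sum_mono)
    fix ms assume ms: "ms \<in> Ms"
    have len: "length (e ms) = n" using e ms by (auto simp: E_def Xs_def)
    have "(\<Sum>ys | length ys = n \<and> dec e ys \<noteq> ms. Pc (shift ys (e ms)))
        = (\<Sum>ys\<in>Ys. Pc (shift ys (e ms)) * of_bool (dec e ys \<noteq> ms))"
      by (rule sum.mono_neutral_cong_left) (use fin in \<open>auto simp: Ys_def\<close>)
    also have "\<dots> = (\<Sum>xz\<in>Ys. Pc xz * of_bool (dec e (unshift xz (e ms)) \<noteq> ms))"
      unfolding Ys_def by (rule sum_shift[OF len, of "\<lambda>xz ys. Pc xz * of_bool (dec e ys \<noteq> ms)"])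
    also have "\<dots> \<le> (\<Sum>xz\<in>Ys. Pc xz * of_bool (B e ms xz))"
    proof (intro sum_mono mult_left_mono Pc0)
      fix xz assume "xz \<in> Ys"
      hence "shift (unshift xz (e ms)) (e ms) = xz" using len by (intro shift_unshift) (simp add: Ys_def)
      hence "dec e (unshift xz (e ms)) \<noteq> ms \<Longrightarrow> B e ms xz"
        unfolding B_def using dec(1) dec(2)[OF ms, of "unshift xz (e ms)" e]
        by (intro bexI[of _ "dec e (unshift xz (e ms))"]) auto
      thus "(of_bool (dec e (unshift xz (e ms)) \<noteq> ms) :: real) \<le> of_bool (B e ms xz)" by auto
    qed
    finally show "P ms * (\<Sum>ys | length ys = n \<and> dec e ys \<noteq> ms. Pc (shift ys (e ms)))
        \<le> (\<Sum>xz\<in>Ys. P ms * Pc xz * of_bool (B e ms xz))"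
      using P0 by (simp add: sum_distrib_left mult.assoc mult_left_mono flip: sum_distrib_left)
  qed
  have avg: "P ms * Pc xz * (\<Sum>e\<in>E. of_bool (B e ms xz)) \<le>
      real (card E) * (P ms * Pc xz * min 1 (Q (map snd xz) / (P ms * Pc xz * N)))"
    if ms: "ms \<in> Ms" and xz: "xz \<in> Ys" for ms xz
  proof (cases "P ms * Pc xz = 0")
    case False
    define c where "c = P ms * Pc xz"
    have c: "c > 0" using False P0[of ms] Pc0[of xz] by (simp add: c_def order_less_le)
    have b1: "(\<Sum>e\<in>E. of_bool (B e ms xz)) \<le> real (card E) * 1"
      using sum_bounded_above[of E "\<lambda>e. of_bool (B e ms xz)" "1::real"] by simp
    \<comment> \<open>Redrawing the codeword of \<open>ms'\<close> leaves \<open>e ms\<close>, and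
      hence the output, unchanged since ms' \<noteq> ms; the likelihood of \<open>ms'\<close> then
      averages to Q / N.\<close>
    have res: "(\<Sum>e\<in>E. Pc (shift (unshift xz (e ms)) (e ms'))) = real (card E) * Q (map snd xz) / N"
      if ms': "ms' \<in> Ms - {ms}" for ms'
    proof -
      let ?G = "\<lambda>e. Pc (shift (unshift xz (e ms)) (e ms'))"
      have "N * (\<Sum>e\<in>E. ?G e) = (\<Sum>e\<in>E. \<Sum>u\<in>Xs. ?G (e(ms' := u)))"
        unfolding E_def using ms' by (subst sum_resample) (auto simp: N)
      also have "\<dots> = (\<Sum>e\<in>E. Q (map snd xz))"
      proof (rule sum.cong)
        fix e assume "e \<in> E"
        hence len: "length (e ms) = n" using ms by (auto simp: E_def Xs_def)
        have lxz: "length xz = n" using xz by (simp add: Ys_def)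
        have "(\<Sum>u\<in>Xs. ?G (e(ms' := u))) = (\<Sum>u\<in>Xs. Pc (shift (unshift xz (e ms)) u))"
          using ms' by (intro sum.cong) auto
        also have "\<dots> = (\<Sum>xs\<in>Xs. Pc (zip xs (map snd (unshift xz (e ms)))))"
          unfolding Xs_def by (rule sum_shift_arg) (use len lxz in simp)
        also have "map snd (unshift xz (e ms)) = map snd xz"
          by (rule map_snd_unshift) (use len lxz in simp)
        also have "(\<Sum>xs\<in>Xs. Pc (zip xs (map snd xz))) = Q (map snd xz)"
          unfolding Xs_def by (rule Q) (use lxz in simp)
        finally show "(\<Sum>u\<in>Xs. ?G (e(ms' := u))) = Q (map snd xz)" .
      qed simp
      finally show ?thesis using N by (simp add: field_simps)
    qed
    \<comment> \<open>Union bound: if \<open>B\<close> holds, one of these nonnegative ratios is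
      already at least 1.\<close>
    have "(\<Sum>e\<in>E. of_bool (B e ms xz)) \<le> (\<Sum>e\<in>E. \<Sum>ms'\<in>Ms - {ms}. P ms' * Pc (shift (unshift xz (e ms)) (e ms')) / c)"
    proof (rule sum_mono)
      fix e
      let ?t = "\<lambda>ms'. P ms' * Pc (shift (unshift xz (e ms)) (e ms')) / c"
      have nn: "?t ms' \<ge> 0" for ms' using c P0 Pc0 by simp
      show "of_bool (B e ms xz) \<le> (\<Sum>ms'\<in>Ms - {ms}. ?t ms')"
      proof (cases "B e ms xz")
        case True
        then obtain m where m: "m \<in> Ms - {ms}" "c \<le> P m * Pc (shift (unshift xz (e ms)) (e m))"
          unfolding B_def c_def by blast
        have "1 \<le> ?t m" using m c by simp
        also have "\<dots> \<le> (\<Sum>ms'\<in>Ms - {ms}. ?t ms')" using m fin nn by (intro member_le_sum) auto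
        finally show ?thesis using True by simp
      qed (use nn in \<open>auto intro: sum_nonneg\<close>)
    qed
    also have "\<dots> = (\<Sum>ms'\<in>Ms - {ms}. P ms' / c * (\<Sum>e\<in>E. Pc (shift (unshift xz (e ms)) (e ms'))))"
      by (subst sum.swap) (simp add: sum_distrib_left)
    also have "\<dots> = (\<Sum>ms'\<in>Ms - {ms}. P ms' / c * (real (card E) * Q (map snd xz) / N))"
      by (intro sum.cong refl) (simp only: res)
    also have "\<dots> = (\<Sum>ms'\<in>Ms - {ms}. P ms') * (real (card E) * (Q (map snd xz) / (c * N)))"
      unfolding sum_distrib_right by (intro sum.cong refl) simp
    also have "\<dots> \<le> 1 * (real (card E) * (Q (map snd xz) / (c * N)))"
    proof (rule mult_right_mono)
      have "(\<Sum>ms'\<in>Ms - {ms}. P ms') \<le> (\<Sum>ms'\<in>Ms. P ms')" by (rule sum_mono2) (use fin P0 in auto)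
      thus "(\<Sum>ms'\<in>Ms - {ms}. P ms') \<le> 1" using P1 by (simp add: Ms_def)
      have "Q (map snd xz) \<ge> 0"
        using xz by (subst Q[symmetric]) (auto simp: Ys_def intro!: sum_nonneg Pc0)
      thus "0 \<le> real (card E) * (Q (map snd xz) / (c * N))" using c N cE by simp
    qed
    finally have b2: "(\<Sum>e\<in>E. of_bool (B e ms xz)) \<le> real (card E) * (Q (map snd xz) / (c * N))" by simp
    have "(\<Sum>e\<in>E. of_bool (B e ms xz)) \<le> real (card E) * min 1 (Q (map snd xz) / (c * N))"
      using b1 b2 by (simp add: min_def)
    hence "c * (\<Sum>e\<in>E. of_bool (B e ms xz)) \<le> c * (real (card E) * min 1 (Q (map snd xz) / (c * N)))"
      using c by (intro mult_left_mono) auto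
    thus ?thesis unfolding c_def by (simp only: mult.left_commute)
  qed auto
  have "(\<Sum>e\<in>E. err e) \<le> (\<Sum>e\<in>E. \<Sum>ms\<in>Ms. \<Sum>xz\<in>Ys. P ms * Pc xz * of_bool (B e ms xz))"
    by (intro sum_mono err_le)
  also have "\<dots> = (\<Sum>ms\<in>Ms. \<Sum>xz\<in>Ys. P ms * Pc xz * (\<Sum>e\<in>E. of_bool (B e ms xz)))"
    unfolding sum_distrib_left by (subst sum.swap) (intro sum.cong refl sum.swap)
  also have "\<dots> \<le> (\<Sum>ms\<in>Ms. \<Sum>xz\<in>Ys. real (card E) * (P ms * Pc xz * min 1 (Q (map snd xz) / (P ms * Pc xz * N))))"
    by (intro sum_mono avg)
  also have "\<dots> = real (card E) * T" by (simp add: T_def sum_distrib_left)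
  finally have total: "(\<Sum>e\<in>E. err e) \<le> real (card E) * T" .
  have "\<exists>e\<in>E. err e \<le> T"
  proof (rule ccontr)
    assume "\<not> ?thesis"
    hence "(\<Sum>e\<in>E. T) < (\<Sum>e\<in>E. err e)" using finE \<open>E \<noteq> {}\<close> by (intro sum_strict_mono) auto
    thus False using total by simp
  qed
  then obtain e where e: "e \<in> E" "err e \<le> T" by blast
  have "\<forall>ms. length ms = k \<longrightarrow> length (e ms) = n" using e(1) by (auto simp: E_def Ms_def Xs_def)
  thus ?thesis using e(2) unfolding err_def T_def Ms_def Ys_def N_def by blast
qed

text \<open>For every output at most one message is decoded correctly, so the correct-decoding probability
  within the event of the indicator is at most \<open>\<gamma>\<close>.\<close>

lemma error_lower_bound:
  fixes P :: "'m::finite list \<Rightarrow> real" and Pc :: "('x::{finite,ab_group_add} \<times> 'z::finite) list \<Rightarrow> real"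
    and Q :: "'z list \<Rightarrow> real"
  assumes P0: "\<And>ms. P ms \<ge> 0" and Pc0: "\<And>ys. Pc ys \<ge> 0" and Q0: "\<And>zs. Q zs \<ge> 0"
    and Q1: "(\<Sum>zs | length zs = n. Q zs) = 1" and \<gamma>: "\<gamma> \<ge> 0"
    and e: "\<And>ms. length ms = k \<Longrightarrow> length (e ms) = n"
  shows "(\<Sum>ms | length ms = k. \<Sum>xz | length xz = n. P ms * Pc xz *
            of_bool (P ms * Pc xz * real CARD('x) ^ n \<le> \<gamma> * Q (map snd xz))) \<le>
    (\<Sum>ms | length ms = k. P ms * (\<Sum>ys | length ys = n \<and> d ys \<noteq> ms. Pc (shift ys (e ms)))) + \<gamma>"
proof -
  define Ms where "Ms = {ms::'m list. length ms = k}"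
  define Ys where "Ys = {ys::('x \<times> 'z) list. length ys = n}"
  define N where "N = real CARD('x) ^ n"
  have fin: "finite Ms" "finite Ys" by (auto simp: Ms_def Ys_def)
  have N: "N > 0" by (simp add: N_def)
  have one: "(\<Sum>xz\<in>Ys. P ms * Pc xz * of_bool (P ms * Pc xz * N \<le> \<gamma> * Q (map snd xz))) \<le>
      P ms * (\<Sum>ys | length ys = n \<and> d ys \<noteq> ms. Pc (shift ys (e ms))) +
      (\<Sum>ys\<in>Ys. \<gamma> * Q (map snd ys) / N * of_bool (d ys = ms))" if ms: "ms \<in> Ms" for ms
  proof -
    have len: "length (e ms) = n" using e ms by (simp add: Ms_def)
    have "(\<Sum>xz\<in>Ys. P ms * Pc xz * of_bool (P ms * Pc xz * N \<le> \<gamma> * Q (map snd xz)))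
       = (\<Sum>ys\<in>Ys. P ms * Pc (shift ys (e ms)) * of_bool (P ms * Pc (shift ys (e ms)) * N \<le> \<gamma> * Q (map snd (shift ys (e ms)))))"
      unfolding Ys_def
      by (rule sum_shift[OF len, symmetric, of "\<lambda>xz _. P ms * Pc xz * of_bool (P ms * Pc xz * N \<le> \<gamma> * Q (map snd xz))"])
    \<comment> \<open>If \<open>d ys\<close> is another message, the error term covers the left
      side. If it is \<open>ms\<close>, the indicator permits replacing the joint probability by its
      bound \<gamma> Q / N.\<close>
    also have "\<dots> \<le> (\<Sum>ys\<in>Ys. P ms * (Pc (shift ys (e ms)) * of_bool (d ys \<noteq> ms)) +
        \<gamma> * Q (map snd ys) / N * of_bool (d ys = ms))"
    proof (rule sum_mono)
      fix ys assume "ys \<in> Ys"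
      hence "map snd (shift ys (e ms)) = map snd ys" using len by (intro map_snd_shift) (simp add: Ys_def)
      moreover have "0 \<le> \<gamma> * Q (map snd ys) / N" using \<gamma> N Q0 by simp
      ultimately show "P ms * Pc (shift ys (e ms)) * of_bool (P ms * Pc (shift ys (e ms)) * N \<le> \<gamma> * Q (map snd (shift ys (e ms))))
         \<le> P ms * (Pc (shift ys (e ms)) * of_bool (d ys \<noteq> ms)) + \<gamma> * Q (map snd ys) / N * of_bool (d ys = ms)"
        using N P0[of ms] Pc0[of "shift ys (e ms)"] by (cases "d ys = ms") (auto simp: pos_le_divide_eq)
    qed
    also have "\<dots> = P ms * (\<Sum>ys\<in>Ys. Pc (shift ys (e ms)) * of_bool (d ys \<noteq> ms)) +
        (\<Sum>ys\<in>Ys. \<gamma> * Q (map snd ys) / N * of_bool (d ys = ms))"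
      by (simp only: sum.distrib sum_distrib_left)
    also have "(\<Sum>ys\<in>Ys. Pc (shift ys (e ms)) * of_bool (d ys \<noteq> ms)) = (\<Sum>ys | length ys = n \<and> d ys \<noteq> ms. Pc (shift ys (e ms)))"
      by (rule sum.mono_neutral_cong_right) (use fin in \<open>auto simp: Ys_def\<close>)
    finally show ?thesis .
  qed
  have "(\<Sum>ms\<in>Ms. \<Sum>ys\<in>Ys. \<gamma> * Q (map snd ys) / N * of_bool (d ys = ms))
     = (\<Sum>ys\<in>Ys. \<gamma> * Q (map snd ys) / N * (\<Sum>ms\<in>Ms. of_bool (d ys = ms)))"
    by (subst sum.swap) (simp add: sum_distrib_left)
  also have "\<dots> \<le> (\<Sum>ys\<in>Ys. \<gamma> * Q (map snd ys) / N * 1)"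
  proof (intro sum_mono mult_left_mono)
    fix ys
    have "(\<Sum>ms\<in>Ms. of_bool (d ys = ms) :: real) = (\<Sum>ms\<in>Ms. if d ys = ms then 1 else 0)"
      by (intro sum.cong) auto
    also have "\<dots> \<le> 1" using fin by (simp add: sum.delta')
    finally show "(\<Sum>ms\<in>Ms. of_bool (d ys = ms) :: real) \<le> 1" .
  qed (use \<gamma> N Q0 in auto)
  also have "\<dots> = \<gamma> / N * (\<Sum>ys\<in>Ys. Q (map snd ys))" by (simp add: sum_distrib_left)
  \<comment> \<open>Q / N is a probability distribution on outputs, with uniform X-part: the
    \<open>N\<close> words \<open>xs\<close> over each \<open>zs\<close> cancel the 1 / N.\<close>
  also have "(\<Sum>ys\<in>Ys. Q (map snd ys)) = (\<Sum>zs | length zs = n. \<Sum>xs::'x list | length xs = n. Q zs)"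
    unfolding Ys_def sum_words_zip by (intro sum.cong refl) simp
  also have "\<dots> = N" using Q1 by (simp add: card_words N_def flip: sum_distrib_left)
  finally have two: "(\<Sum>ms\<in>Ms. \<Sum>ys\<in>Ys. \<gamma> * Q (map snd ys) / N * of_bool (d ys = ms)) \<le> \<gamma>" using N by simp
  have "(\<Sum>ms\<in>Ms. \<Sum>xz\<in>Ys. P ms * Pc xz * of_bool (P ms * Pc xz * N \<le> \<gamma> * Q (map snd xz))) \<le>
      (\<Sum>ms\<in>Ms. P ms * (\<Sum>ys | length ys = n \<and> d ys \<noteq> ms. Pc (shift ys (e ms))) +
      (\<Sum>ys\<in>Ys. \<gamma> * Q (map snd ys) / N * of_bool (d ys = ms)))"
    by (intro sum_mono one)
  also have "\<dots> \<le> (\<Sum>ms\<in>Ms. P ms * (\<Sum>ys | length ys = n \<and> d ys \<noteq> ms. Pc (shift ys (e ms)))) + \<gamma>"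
    using two by (simp add: sum.distrib)
  finally show ?thesis unfolding Ms_def Ys_def N_def .
qed

section \<open>Moderate deviations\<close>

text \<open>On the window from \<eta> to 3\<eta> the exponential is bounded by its largest value.
  Outside, the tilt is changed by \<open>b\<close> towards the tail in question: exp (b (x -
  3\<eta>)) above the window and exp (b (\<eta> - x)) below it are at least 1.\<close>

lemma exp_tail_decomposition:
  fixes a b \<eta> x :: real
  assumes "a > 0" "b > 0" "\<eta> > 0"
  shows "exp (a * x) \<le> exp (3 * \<eta> * a) * of_bool (\<eta> \<le> x) + exp (- (3 * \<eta> * b)) * exp ((a + b) * x) +
           exp (\<eta> * b) * exp ((a - b) * x)"
proof -
  have split: "exp (- (3 * \<eta> * b)) * exp ((a + b) * x) = exp (a * x + b * (x - 3 * \<eta>))"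
    "exp (\<eta> * b) * exp ((a - b) * x) = exp (a * x + b * (\<eta> - x))"
    unfolding exp_add[symmetric] by (simp_all add: algebra_simps)
  have nn: "0 \<le> exp (3 * \<eta> * a) * of_bool (\<eta> \<le> x)" by simp
  note e0 = exp_ge_zero[of "a * x + b * (x - 3 * \<eta>)"] exp_ge_zero[of "a * x + b * (\<eta> - x)"]
  consider "x > 3 * \<eta>" | "x < \<eta>" | "\<eta> \<le> x" "x \<le> 3 * \<eta>" by linarith
  thus ?thesis
  proof cases
    case 1
    hence "exp (a * x) \<le> exp (a * x + b * (x - 3 * \<eta>))" using assms by simp
    thus ?thesis unfolding split using nn e0 by linarith
  next
    case 2
    hence "exp (a * x) \<le> exp (a * x + b * (\<eta> - x))" using assms by simp
    thus ?thesis unfolding split using nn e0 by linarith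
  next
    case 3
    hence "a * x \<le> 3 * \<eta> * a" using assms by (simp add: mult.commute)
    hence "exp (a * x) \<le> exp (3 * \<eta> * a) * of_bool (\<eta> \<le> x)" using 3 by simp
    thus ?thesis unfolding split using e0 by linarith
  qed
qed

text \<open>The lower half of the Gaertner-Ellis theorem for a quadratic limit: under the exponentially
  tilted weights with parameter \<open>a = (\<kappa> + 2\<eta>)/V\<close> the variable concentrates at \<open>2\<eta>\<close>.\<close>

lemma quadratic_mgf_lower_tail:
  fixes \<Omega> :: "nat \<Rightarrow> 'i set" and w X :: "nat \<Rightarrow> 'i \<Rightarrow> real" and s :: "nat \<Rightarrow> real"
  defines "M \<equiv> \<lambda>n a. \<Sum>i\<in>\<Omega> n. w n i * exp (a * (s n * X n i))"
  assumes w0: "\<And>n i. w n i \<ge> 0" and s: "filterlim s at_top sequentially"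
    and V: "V > 0" and \<kappa>: "\<kappa> > 0" and \<eta>: "\<eta> > 0"
    and M0: "\<And>a. a > 0 \<Longrightarrow> \<forall>\<^sub>F n in sequentially. M n a > 0"
    and lim: "\<And>a. a > 0 \<Longrightarrow> (\<lambda>n. ln (M n a) / s n) \<longlonglongrightarrow> a\<^sup>2 * V / 2 - \<kappa> * a"
  shows "\<forall>\<^sub>F n in sequentially. exp (- s n * (\<kappa>\<^sup>2 / (2 * V) + 3 * \<eta> * (\<kappa> + 2 * \<eta>) / V)) \<le>
           (\<Sum>i\<in>\<Omega> n. w n i * of_bool (\<eta> \<le> X n i))"
proof -
  \<comment> \<open>With \<Lambda> the limit function, \<open>a\<close> is the point where its
    derivative is 2\<eta>, the middle of the window. \<open>b\<close> minimises both \<Lambda>(a+b)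
    - 3\<eta>b and \<Lambda>(a-b) + \<eta>b, and \<open>g\<close> is how far these minima lie below
    \<Lambda>(a).\<close>
  define a b g where "a = (\<kappa> + 2 * \<eta>) / V" and "b = \<eta> / V" and "g = \<eta>\<^sup>2 / (2 * V)"
  define \<Lambda> where "\<Lambda> = (\<lambda>a. a\<^sup>2 * V / 2 - \<kappa> * a)"
  have ab: "a > 0" "b > 0" "a + b > 0" "a - b > 0" "g > 0"
    using V \<kappa> \<eta> by (auto simp: a_def b_def g_def add_divide_distrib intro!: add_pos_pos divide_strict_right_mono)
  have L1: "\<Lambda> (a + b) - 3 * \<eta> * b = \<Lambda> a - g" "\<Lambda> (a - b) + \<eta> * b = \<Lambda> a - g"
    using V by (simp_all add: \<Lambda>_def a_def b_def g_def field_simps power2_eq_square)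
  have L2: "\<Lambda> a = 4 * g - \<kappa>\<^sup>2 / (2 * V)"
    using V by (simp add: \<Lambda>_def a_def g_def field_simps power2_eq_square)
  have g4: "g / 4 > 0" using ab by simp
  have e1: "\<forall>\<^sub>F n in sequentially. dist (ln (M n a) / s n) (\<Lambda> a) < g / 4"
    using tendstoD[OF lim[OF ab(1)] g4] by (simp add: \<Lambda>_def)
  have e2: "\<forall>\<^sub>F n in sequentially. dist (ln (M n (a + b)) / s n) (\<Lambda> (a + b)) < g / 4"
    using tendstoD[OF lim[OF ab(3)] g4] by (simp add: \<Lambda>_def)
  have e3: "\<forall>\<^sub>F n in sequentially. dist (ln (M n (a - b)) / s n) (\<Lambda> (a - b)) < g / 4"
    using tendstoD[OF lim[OF ab(4)] g4] by (simp add: \<Lambda>_def)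
  \<comment> \<open>Gives s g / 2 \<ge> 4, hence exp (s g / 2) \<ge> 4, the factor that separates
    \<open>m\<close> from \<open>r\<close> below.\<close>
  have e4: "\<forall>\<^sub>F n in sequentially. s n \<ge> max 1 (8 / g)"
    using s unfolding filterlim_at_top by blast
  show ?thesis
    using e1 e2 e3 e4 M0[OF ab(1)] M0[OF ab(3)] M0[OF ab(4)]
  proof eventually_elim
    case (elim n)
    have sn: "s n > 0" "s n * g \<ge> 8" using elim(4) ab by (auto simp: pos_divide_le_eq)
    let ?P = "\<Sum>i\<in>\<Omega> n. w n i * of_bool (\<eta> \<le> X n i)"
    \<comment> \<open>Each limit is reached within g / 4: the moment sum at \<open>a\<close> is at
      least \<open>m\<close>, and each of the two tail terms is at most \<open>r\<close>, as - g +
      g/4 = - 3g/4.\<close>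
    define m where "m = exp (s n * (\<Lambda> a - g / 4))"
    define r where "r = exp (s n * (\<Lambda> a - 3 * g / 4))"
    have "\<Lambda> a - g / 4 \<le> ln (M n a) / s n" using elim(1) unfolding dist_real_def abs_less_iff by linarith
    hence "s n * (\<Lambda> a - g / 4) \<le> ln (M n a)" using sn by (simp add: pos_le_divide_eq mult.commute)
    hence m: "m \<le> M n a" using elim(5) by (simp add: m_def ln_ge_iff)
    have "ln (M n (a + b)) / s n \<le> \<Lambda> (a + b) + g / 4" using elim(2) unfolding dist_real_def abs_less_iff by linarith
    hence "ln (M n (a + b)) \<le> s n * (\<Lambda> (a + b) + g / 4)" using sn by (simp add: pos_divide_le_eq mult.commute)
    hence "M n (a + b) \<le> exp (s n * (\<Lambda> (a + b) + g / 4))" using elim(6) by (metis exp_le_cancel_iff exp_ln)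
    hence "exp (- (3 * (s n * \<eta>) * b)) * M n (a + b) \<le> exp (- (3 * (s n * \<eta>) * b)) * exp (s n * (\<Lambda> (a + b) + g / 4))"
      by (rule mult_left_mono) simp
    also have "\<dots> = exp (s n * ((\<Lambda> (a + b) - 3 * \<eta> * b) + g / 4))"
      unfolding exp_add[symmetric] by (simp add: algebra_simps)
    also have "\<dots> = r" unfolding L1 r_def by (rule arg_cong[of _ _ exp]) (simp add: algebra_simps)
    finally have r1: "exp (- (3 * (s n * \<eta>) * b)) * M n (a + b) \<le> r" .
    have "ln (M n (a - b)) / s n \<le> \<Lambda> (a - b) + g / 4" using elim(3) unfolding dist_real_def abs_less_iff by linarith
    hence "ln (M n (a - b)) \<le> s n * (\<Lambda> (a - b) + g / 4)" using sn by (simp add: pos_divide_le_eq mult.commute)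
    hence "M n (a - b) \<le> exp (s n * (\<Lambda> (a - b) + g / 4))" using elim(7) by (metis exp_le_cancel_iff exp_ln)
    hence "exp (s n * \<eta> * b) * M n (a - b) \<le> exp (s n * \<eta> * b) * exp (s n * (\<Lambda> (a - b) + g / 4))"
      by (rule mult_left_mono) simp
    also have "\<dots> = exp (s n * ((\<Lambda> (a - b) + \<eta> * b) + g / 4))"
      unfolding exp_add[symmetric] by (simp add: algebra_simps)
    also have "\<dots> = r" unfolding L1 r_def by (rule arg_cong[of _ _ exp]) (simp add: algebra_simps)
    finally have r2: "exp (s n * \<eta> * b) * M n (a - b) \<le> r" .
    have "M n a \<le> (\<Sum>i\<in>\<Omega> n. w n i * (exp (3 * (s n * \<eta>) * a) * of_bool (s n * \<eta> \<le> s n * X n i) +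
        exp (- (3 * (s n * \<eta>) * b)) * exp ((a + b) * (s n * X n i)) + exp (s n * \<eta> * b) * exp ((a - b) * (s n * X n i))))"
      unfolding M_def using ab \<eta> sn by (intro sum_mono mult_left_mono exp_tail_decomposition w0) auto
    also have "\<dots> = exp (3 * (s n * \<eta>) * a) * ?P + exp (- (3 * (s n * \<eta>) * b)) * M n (a + b) + exp (s n * \<eta> * b) * M n (a - b)"
      using sn by (simp add: M_def ring_distribs sum.distrib sum_distrib_left mult.left_commute)
    finally have "m \<le> exp (3 * (s n * \<eta>) * a) * ?P + 2 * r" using m r1 r2 by linarith
    moreover have "4 * r \<le> m"
    proof -
      have "4 * r \<le> (1 + s n * g / 2) * r" using sn by (intro mult_right_mono) (auto simp: r_def)
      also have "\<dots> \<le> exp (s n * g / 2) * r"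
        by (intro mult_right_mono exp_ge_add_one_self) (auto simp: r_def)
      also have "\<dots> = m" unfolding r_def m_def exp_add[symmetric] by (simp add: algebra_simps)
      finally show ?thesis .
    qed
    ultimately have "r \<le> exp (3 * (s n * \<eta>) * a) * ?P" using exp_gt_zero[of "s n * (\<Lambda> a - 3 * g / 4)"]
      unfolding r_def[symmetric] by linarith
    hence "exp (- (3 * (s n * \<eta>) * a)) * r \<le> exp (- (3 * (s n * \<eta>) * a)) * (exp (3 * (s n * \<eta>) * a) * ?P)"
      by (rule mult_left_mono) simp
    also have "\<dots> = ?P" by (simp add: mult.assoc[symmetric] exp_add[symmetric])
    finally have P: "exp (- (3 * (s n * \<eta>) * a)) * r \<le> ?P" .
    have "exp (- s n * (\<kappa>\<^sup>2 / (2 * V) + 3 * \<eta> * (\<kappa> + 2 * \<eta>) / V)) = exp (- s n * (\<kappa>\<^sup>2 / (2 * V) + 3 * \<eta> * a))"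
      by (simp add: a_def)
    \<comment> \<open>13/4 = 4 - 3/4, from the 4g in \<open>L2\<close> and the 3g/4 in
      \<open>r\<close>; this positive surplus is given away.\<close>
    also have "\<dots> \<le> exp (- s n * (\<kappa>\<^sup>2 / (2 * V) + 3 * \<eta> * a) + s n * (13 / 4 * g))"
      using sn ab by simp
    also have "\<dots> = exp (- (3 * (s n * \<eta>) * a)) * r"
      unfolding r_def exp_add[symmetric] L2 by (simp add: algebra_simps)
    finally show ?case using P by linarith
  qed
qed

text \<open>The first-order term is in general of larger order than the normaliser, so it stays on
  the left, to be cancelled when source and channel are combined. Uniformity of the hypothesis in
  the block length permits the substitution of \<open>k n\<close>.\<close>

lemma moderate_scale_mgf_limit:
  fixes S :: "nat \<Rightarrow> real \<Rightarrow> real" and k :: "nat \<Rightarrow> nat"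
  assumes S: "\<And>\<epsilon>. \<epsilon> > 0 \<Longrightarrow> \<forall>\<^sub>F \<theta> in at 0. \<forall>n\<ge>1. S n \<theta> > 0 \<and>
      \<bar>ln (S n \<theta>) - real n * (H * \<theta> + v * \<theta>\<^sup>2 / 2)\<bar> \<le> real n * (\<epsilon> * \<theta>\<^sup>2) + 8"
    and k1: "\<forall>\<^sub>F n in sequentially. k n \<ge> 1" and kr: "(\<lambda>n. real (k n) / real n) \<longlonglongrightarrow> r"
    and t: "0 < t" "t < 1/2" and a: "a > 0"
  shows "\<forall>\<^sub>F n in sequentially. S (k n) (a * real n powr - t) > 0"
    and "(\<lambda>n. (ln (S (k n) (a * real n powr - t)) - real (k n) * H * (a * real n powr - t)) / real n powr (1 - 2 * t))
      \<longlonglongrightarrow> r * (a\<^sup>2 * v / 2)"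
proof -
  define \<theta> where "\<theta> = (\<lambda>n. a * real n powr - t)"
  define s where "s = (\<lambda>n. real n powr (1 - 2 * t))"
  have "(\<lambda>n. real n powr - t) \<longlonglongrightarrow> 0"
    using t by (intro tendsto_neg_powr filterlim_real_sequentially) auto
  hence \<theta>0: "\<theta> \<longlonglongrightarrow> a * 0" unfolding \<theta>_def by (intro tendsto_intros)
  have pos: "\<forall>\<^sub>F n in sequentially. n \<ge> (1::nat)" by (rule eventually_ge_at_top)
  have "\<forall>\<^sub>F n in sequentially. \<theta> n \<noteq> 0" using pos by eventually_elim (use a in \<open>auto simp: \<theta>_def\<close>)
  hence \<theta>at: "filterlim \<theta> (at 0) sequentially" using \<theta>0 by (simp add: filterlim_at)
  have ev: "\<forall>\<^sub>F n in sequentially. \<forall>m\<ge>1. S m (\<theta> n) > 0 \<and>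
      \<bar>ln (S m (\<theta> n)) - real m * (H * \<theta> n + v * (\<theta> n)\<^sup>2 / 2)\<bar> \<le> real m * (\<epsilon> * (\<theta> n)\<^sup>2) + 8" if "\<epsilon> > 0" for \<epsilon>
    using S[OF that] \<theta>at by (rule eventually_compose_filterlim)
  show "\<forall>\<^sub>F n in sequentially. S (k n) (a * real n powr - t) > 0"
    using ev[of 1, simplified] k1 by eventually_elim (auto simp: \<theta>_def)
  have s_top: "filterlim s at_top sequentially"
    unfolding s_def using t by real_asymp
  have \<theta>2: "(\<theta> n)\<^sup>2 = a\<^sup>2 * (s n / real n)" if "n \<ge> 1" for n
  proof -
    have "(real n powr - t)\<^sup>2 = real n powr (- t + - t)" unfolding powr_add by (simp add: power2_eq_square)
    also have "\<dots> = real n powr (1 - 2 * t) / real n powr 1"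
      unfolding powr_diff[symmetric] by simp
    finally show ?thesis using that by (simp add: \<theta>_def s_def power_mult_distrib)
  qed
  define D where "D = (\<lambda>n. (ln (S (k n) (\<theta> n)) - real (k n) * (H * \<theta> n + v * (\<theta> n)\<^sup>2 / 2)) / s n)"
  have D: "D \<longlonglongrightarrow> 0"
  proof (rule tendstoI)
    fix e :: real assume e: "e > 0"
    have r0: "r \<ge> 0" by (rule tendsto_lowerbound[OF kr]) auto
    \<comment> \<open>Eventually k n / n < r + 1, so the error per letter contributes at most (r +
      1) \<epsilon> a^2 = e / 2, and the constant 8 at most e / 4.\<close>
    define \<epsilon> where "\<epsilon> = e / (2 * (r + 1) * a\<^sup>2)"
    have \<epsilon>: "\<epsilon> > 0" using e r0 a by (simp add: \<epsilon>_def)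
    have "\<forall>\<^sub>F n in sequentially. real (k n) / real n < r + 1" by (rule order_tendstoD[OF kr]) simp
    moreover have "\<forall>\<^sub>F n in sequentially. s n \<ge> max 1 (32 / e)" using s_top unfolding filterlim_at_top by blast
    ultimately show "\<forall>\<^sub>F n in sequentially. dist (D n) 0 < e" using ev[OF \<epsilon>] k1 pos
    proof eventually_elim
      case (elim n)
      have sn: "s n > 0" "8 / s n \<le> e / 4" using elim(2) e by (auto simp: field_simps)
      have "\<bar>D n\<bar> = \<bar>ln (S (k n) (\<theta> n)) - real (k n) * (H * \<theta> n + v * (\<theta> n)\<^sup>2 / 2)\<bar> / s n"
        using sn by (simp add: D_def abs_divide)
      also have "\<dots> \<le> (real (k n) * (\<epsilon> * (\<theta> n)\<^sup>2) + 8) / s n"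
        using elim(3,4) sn by (intro divide_right_mono) auto
      also have "\<dots> = real (k n) / real n * (\<epsilon> * a\<^sup>2) + 8 / s n"
        using elim(5) sn by (simp add: \<theta>2 add_divide_distrib)
      also have "\<dots> \<le> (r + 1) * (\<epsilon> * a\<^sup>2) + e / 4"
        using elim(1) \<epsilon> sn by (intro add_mono mult_right_mono) auto
      also have "(r + 1) * (\<epsilon> * a\<^sup>2) = e / 2"
      proof -
        have "r + 1 \<noteq> 0" using r0 by linarith
        thus ?thesis using a unfolding \<epsilon>_def by (simp add: divide_simps)
      qed
      finally show ?case using e by (simp add: dist_real_def)
    qed
  qed
  have "(\<lambda>n. D n + real (k n) / real n * (a\<^sup>2 * v / 2)) \<longlonglongrightarrow> 0 + r * (a\<^sup>2 * v / 2)"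
    by (intro tendsto_intros D kr)
  moreover have "\<forall>\<^sub>F n in sequentially. D n + real (k n) / real n * (a\<^sup>2 * v / 2) =
     (ln (S (k n) (a * real n powr - t)) - real (k n) * H * (a * real n powr - t)) / real n powr (1 - 2 * t)"
    using pos
  proof eventually_elim
    case (elim n)
    have "s n \<noteq> 0" using elim by (simp add: s_def)
    hence "real (k n) / real n * (a\<^sup>2 * v / 2) = real (k n) * (v * (\<theta> n)\<^sup>2 / 2) / s n"
      using elim by (simp add: \<theta>2)
    thus ?case unfolding D_def
      by (simp add: ring_distribs diff_divide_distrib add_divide_distrib mult.assoc) (simp add: \<theta>_def s_def)
  qed
  ultimately have "(\<lambda>n. (ln (S (k n) (a * real n powr - t)) - real (k n) * H * (a * real n powr - t)) / real n powr (1 - 2 * t))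
     \<longlonglongrightarrow> 0 + r * (a\<^sup>2 * v / 2)" by (rule Lim_transform_eventually)
  thus "(\<lambda>n. (ln (S (k n) (a * real n powr - t)) - real (k n) * H * (a * real n powr - t)) / real n powr (1 - 2 * t))
     \<longlonglongrightarrow> r * (a\<^sup>2 * v / 2)" by simp
qed

section \<open>Log-likelihoods as additive path functionals\<close>

definition path_sum :: "('a \<Rightarrow> real) \<Rightarrow> ('a \<Rightarrow> 'a \<Rightarrow> real) \<Rightarrow> 'a list \<Rightarrow> real" where
  "path_sum f0 f xs = (if xs = [] then 0 else f0 (hd xs) + (\<Sum>i\<in>{1..<length xs}. f (xs ! i) (xs ! (i - 1))))"

lemma markov_prob_tilt:
  "markov_prob (\<lambda>a. p a * exp (\<theta> * f0 a)) (\<lambda>b a. W b a * exp (\<theta> * f b a)) xs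
     = markov_prob p W xs * exp (\<theta> * path_sum f0 f xs)"
proof (cases "xs = []")
  case False
  have "exp (\<theta> * path_sum f0 f xs) = exp (\<theta> * f0 (hd xs)) * (\<Prod>i\<in>{1..<length xs}. exp (\<theta> * f (xs ! i) (xs ! (i - 1))))"
    using False unfolding exp_sum[OF finite_atLeastLessThan, symmetric] exp_add[symmetric]
    by (simp add: path_sum_def distrib_left sum_distrib_left)
  thus ?thesis using False by (simp add: markov_prob_def prod.distrib)
qed (simp add: markov_prob_def path_sum_def)

text \<open>A log-likelihood ratio is additive along the path, so tilting by it with \<theta> = 1
  exchanges the measure. A path of weight 0 cannot be restored by any tilt, hence the restriction to
  positive paths.\<close>

lemma markov_prob_change_of_measure:
  assumes p0: "\<And>a. p a \<ge> 0" and W0: "\<And>a b. W b a \<ge> 0"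
    and r: "\<And>a. p a > 0 \<Longrightarrow> r a > 0" and R: "\<And>a b. W b a > 0 \<Longrightarrow> R b a > 0"
    and pos: "markov_prob p W xs > 0"
  shows "markov_prob r R xs =
    markov_prob p W xs * exp (path_sum (\<lambda>a. ln (r a) - ln (p a)) (\<lambda>b a. ln (R b a) - ln (W b a)) xs)"
proof -
  have hd: "r (hd xs) = p (hd xs) * exp (ln (r (hd xs)) - ln (p (hd xs)))" if "xs \<noteq> []"
  proof -
    have "p (hd xs) \<noteq> 0" using pos that by (auto simp: markov_prob_def)
    hence "p (hd xs) > 0" using p0[of "hd xs"] by simp
    thus ?thesis using r[of "hd xs"] by (simp add: exp_diff)
  qed
  have step: "R (xs ! i) (xs ! (i - 1)) = W (xs ! i) (xs ! (i - 1)) * exp (ln (R (xs ! i) (xs ! (i - 1))) - ln (W (xs ! i) (xs ! (i - 1))))"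
    if i: "i \<in> {1..<length xs}" for i
  proof -
    have "xs \<noteq> []" using i by auto
    hence "p (hd xs) * (\<Prod>i\<in>{1..<length xs}. W (xs ! i) (xs ! (i - 1))) > 0" using pos by (simp add: markov_prob_def)
    hence "(\<Prod>i\<in>{1..<length xs}. W (xs ! i) (xs ! (i - 1))) \<noteq> 0" by (metis less_irrefl mult_zero_right)
    hence "W (xs ! i) (xs ! (i - 1)) \<noteq> 0" using i by (subst (asm) prod_zero_iff) auto
    hence "W (xs ! i) (xs ! (i - 1)) > 0" using W0[of "xs ! i" "xs ! (i - 1)"] by simp
    thus ?thesis using R[of "xs ! i" "xs ! (i - 1)"] by (simp add: exp_diff)
  qed
  have "markov_prob r R xs =
    markov_prob (\<lambda>a. p a * exp (1 * (ln (r a) - ln (p a)))) (\<lambda>b a. W b a * exp (1 * (ln (R b a) - ln (W b a)))) xs"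
  proof (cases "xs = []")
    case False
    have 1: "markov_prob r R xs = r (hd xs) * (\<Prod>i\<in>{1..<length xs}. R (xs ! i) (xs ! (i - 1)))"
      and 2: "markov_prob (\<lambda>a. p a * exp (1 * (ln (r a) - ln (p a)))) (\<lambda>b a. W b a * exp (1 * (ln (R b a) - ln (W b a)))) xs =
        p (hd xs) * exp (ln (r (hd xs)) - ln (p (hd xs))) *
        (\<Prod>i\<in>{1..<length xs}. W (xs ! i) (xs ! (i - 1)) * exp (ln (R (xs ! i) (xs ! (i - 1))) - ln (W (xs ! i) (xs ! (i - 1)))))"
      using False by (simp_all add: markov_prob_def)
    show ?thesis unfolding 1 2
      by (rule arg_cong2[of _ _ _ _ "(*)", OF hd[OF False] prod.cong[OF refl step]])
  qed (simp add: markov_prob_def)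
  thus ?thesis unfolding markov_prob_tilt by simp
qed

text \<open>\<open>F\<close> is - ln P as a path functional, obtained by changing the measure to
  constant weights 1. On words of probability 0 it has a default value, which is always multiplied
  by their weight 0.\<close>

lemma source_mgf:
  fixes PM :: "'m::finite \<Rightarrow> real"
  assumes pm: "is_pmf PM" and st: "stochastic Ws" and ir: "irreducible_mc Ws"
  obtains F where
    "\<And>ms. markov_prob PM Ws ms > 0 \<Longrightarrow> markov_prob PM Ws ms = exp (- F ms)"
    "\<And>\<epsilon>. \<epsilon> > 0 \<Longrightarrow> \<forall>\<^sub>F \<theta> in at 0. \<forall>n\<ge>1. (\<Sum>ms | length ms = n. markov_prob PM Ws ms * exp (\<theta> * F ms)) > 0 \<and>
      \<bar>ln (\<Sum>ms | length ms = n. markov_prob PM Ws ms * exp (\<theta> * F ms)) - real n * (Hs Ws * \<theta> + Vs Ws * \<theta>\<^sup>2 / 2)\<bar>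
        \<le> real n * (\<epsilon> * \<theta>\<^sup>2) + 8"
proof -
  have W0: "Ws b a \<ge> 0" for a b using st by (auto simp: stochastic_def)
  have p0: "PM a \<ge> 0" for a using pm by (auto simp: is_pmf_def)
  \<comment> \<open>\<open>ln 1\<close> is kept so that this is literally the log-ratio in
    \<open>markov_prob_change_of_measure\<close> for the weights 1.\<close>
  define f0 where "f0 = (\<lambda>a. ln 1 - ln (PM a))"
  define f where "f = (\<lambda>b a. ln 1 - ln (Ws b a))"
  have "(\<lambda>b a. Ws b a powr (1 - \<theta>)) = (\<lambda>b a. Ws b a * exp (\<theta> * f b a))" for \<theta>
  proof (intro ext)
    fix b a
    show "Ws b a powr (1 - \<theta>) = Ws b a * exp (\<theta> * f b a)"
      using W0[of b a]
      by (cases "Ws b a = 0") (auto simp: f_def powr_def left_diff_distrib exp_diff exp_minus divide_inverse)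
  qed
  hence ren: "Hs_renyi Ws = (\<lambda>\<theta>. ln (pf_eig (\<lambda>b a. Ws b a * exp (\<theta> * f b a))) / \<theta>)"
    by (simp add: Hs_renyi_def fun_eq_iff)
  show ?thesis
  proof (rule tilted_chain_asymptotics[OF st ir, of f])
    fix H v
    assume l1: "((\<lambda>\<theta>. ln (pf_eig (\<lambda>b a. Ws b a * exp (\<theta> * f b a))) / \<theta>) \<longlongrightarrow> H) (at 0)"
      and l2: "((\<lambda>\<theta>. 2 * (ln (pf_eig (\<lambda>b a. Ws b a * exp (\<theta> * f b a))) / \<theta> - H) / \<theta>) \<longlongrightarrow> v) (at 0)"
      and mgf: "\<And>\<epsilon> p f0. \<epsilon> > 0 \<Longrightarrow> is_pmf p \<Longrightarrow> \<forall>\<^sub>F \<theta> in at 0. \<forall>n\<ge>1.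
       (\<Sum>xs | length xs = n. markov_prob (\<lambda>a. p a * exp (\<theta> * f0 a)) (\<lambda>b a. Ws b a * exp (\<theta> * f b a)) xs) > 0 \<and>
       \<bar>ln (\<Sum>xs | length xs = n. markov_prob (\<lambda>a. p a * exp (\<theta> * f0 a)) (\<lambda>b a. Ws b a * exp (\<theta> * f b a)) xs)
          - real n * (H * \<theta> + v * \<theta>\<^sup>2 / 2)\<bar> \<le> real n * (\<epsilon> * \<theta>\<^sup>2) + 8"
    have H: "Hs Ws = H" unfolding Hs_def ren by (rule tendsto_Lim[OF _ l1]) simp
    have v: "Vs Ws = v" unfolding Vs_def H ren by (rule tendsto_Lim[OF _ l2]) simp
    show ?thesis
    proof (rule that[of "path_sum f0 f"])
      fix ms assume pos: "markov_prob PM Ws ms > 0"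
      have "markov_prob (\<lambda>_. 1) (\<lambda>_ _. 1) ms = markov_prob PM Ws ms * exp (path_sum f0 f ms)"
        unfolding f0_def f_def by (rule markov_prob_change_of_measure[OF p0 W0 _ _ pos]) auto
      hence "markov_prob PM Ws ms * exp (path_sum f0 f ms) = 1" by (simp add: markov_prob_def split: if_splits)
      thus "markov_prob PM Ws ms = exp (- path_sum f0 f ms)" by (simp add: exp_minus field_simps)
    qed (use mgf[OF _ pm, of _ f0] in \<open>simp add: H v markov_prob_tilt\<close>)
  qed
qed

text \<open>Here the new measure is the law of Z, read as a function of the pair, so
  \<open>F\<close> is - ln P(x|z). The positivity required for the change of measure holds because a
  marginal dominates each of its summands.\<close>

lemma channel_mgf:
  fixes P :: "('x::{finite,ab_group_add} \<times> 'z::finite) \<Rightarrow> real"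
  assumes pm: "is_pmf P" and st: "stochastic Wc" and ir: "irreducible_mc Wc" and a1: "assumption1 Wc"
  obtains F where
    "\<And>xz. markov_prob P Wc xz > 0 \<Longrightarrow>
       markov_prob (\<lambda>z. \<Sum>x\<in>UNIV. P (x, z)) (WcZ Wc) (map snd xz) = markov_prob P Wc xz * exp (F xz)"
    "\<And>\<epsilon>. \<epsilon> > 0 \<Longrightarrow> \<forall>\<^sub>F \<theta> in at 0. \<forall>n\<ge>1. (\<Sum>xz | length xz = n. markov_prob P Wc xz * exp (\<theta> * F xz)) > 0 \<and>
      \<bar>ln (\<Sum>xz | length xz = n. markov_prob P Wc xz * exp (\<theta> * F xz)) - real n * (Hc Wc * \<theta> + Vc Wc * \<theta>\<^sup>2 / 2)\<bar>
        \<le> real n * (\<epsilon> * \<theta>\<^sup>2) + 8"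
proof -
  define PZ where "PZ = (\<lambda>z. \<Sum>x\<in>UNIV. P (x, z))"
  have W0: "Wc b a \<ge> 0" for a b using st unfolding stochastic_def by blast
  have p0: "P a \<ge> 0" for a using pm unfolding is_pmf_def by blast
  have PZ: "PZ (snd a) > 0" if "P a > 0" for a
    unfolding PZ_def by (rule sum_pos2[of _ "fst a"]) (use that p0 in auto)
  \<comment> \<open>\<open>WcZ\<close> is defined with previous X-state 0; Assumption 1 moves it to
    the actual state, where the sum contains \<open>Wc b a\<close>.\<close>
  have WZ: "WcZ Wc (snd b) (snd a) > 0" if "Wc b a > 0" for a b
  proof -
    have "WcZ Wc (snd b) (snd a) = (\<Sum>x\<in>UNIV. Wc (x, snd b) (fst a, snd a))"
      using a1 unfolding assumption1_def WcZ_def by blast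
    also have "\<dots> > 0" by (rule sum_pos2[of _ "fst b"]) (use that W0 in auto)
    finally show ?thesis .
  qed
  have snd_eq: "markov_prob PZ (WcZ Wc) (map snd xz) = markov_prob (\<lambda>a. PZ (snd a)) (\<lambda>b a. WcZ Wc (snd b) (snd a)) xz" for xz :: "('x \<times> 'z) list"
    by (auto simp: markov_prob_def hd_map intro!: prod.cong)
  define f0 where "f0 = (\<lambda>a. ln (PZ (snd a)) - ln (P a))"
  define f where "f = (\<lambda>b a. ln (WcZ Wc (snd b) (snd a)) - ln (Wc b a))"
  have tilt: "(\<lambda>(x, z) (x', z'). Wc (x, z) (x', z') powr (1 - \<theta>) * WcZ Wc z z' powr \<theta>) = (\<lambda>b a. Wc b a * exp (\<theta> * f b a))" for \<theta>
  proof (intro ext)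
    fix b a :: "'x \<times> 'z"
    have "Wc b a powr (1 - \<theta>) * WcZ Wc (snd b) (snd a) powr \<theta> = Wc b a * exp (\<theta> * f b a)"
    proof (cases "Wc b a = 0")
      case False
      hence pos: "Wc b a > 0" using W0[of b a] by simp
      show ?thesis using pos WZ[OF pos]
        by (simp add: f_def powr_def left_diff_distrib right_diff_distrib exp_diff)
    qed simp
    thus "(case b of (x, z) \<Rightarrow> \<lambda>(x', z'). Wc (x, z) (x', z') powr (1 - \<theta>) * WcZ Wc z z' powr \<theta>) a = Wc b a * exp (\<theta> * f b a)"
      by (simp add: case_prod_beta)
  qed
  have ren: "Hc_renyi Wc = (\<lambda>\<theta>. ln (pf_eig (\<lambda>b a. Wc b a * exp (\<theta> * f b a))) / \<theta>)"
    by (rule ext) (simp only: Hc_renyi_def tilt)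
  show ?thesis
  proof (rule tilted_chain_asymptotics[OF st ir, of f])
    fix H v
    assume l1: "((\<lambda>\<theta>. ln (pf_eig (\<lambda>b a. Wc b a * exp (\<theta> * f b a))) / \<theta>) \<longlongrightarrow> H) (at 0)"
      and l2: "((\<lambda>\<theta>. 2 * (ln (pf_eig (\<lambda>b a. Wc b a * exp (\<theta> * f b a))) / \<theta> - H) / \<theta>) \<longlongrightarrow> v) (at 0)"
      and mgf: "\<And>\<epsilon> p f0. \<epsilon> > 0 \<Longrightarrow> is_pmf p \<Longrightarrow> \<forall>\<^sub>F \<theta> in at 0. \<forall>n\<ge>1.
       (\<Sum>xs | length xs = n. markov_prob (\<lambda>a. p a * exp (\<theta> * f0 a)) (\<lambda>b a. Wc b a * exp (\<theta> * f b a)) xs) > 0 \<and>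
       \<bar>ln (\<Sum>xs | length xs = n. markov_prob (\<lambda>a. p a * exp (\<theta> * f0 a)) (\<lambda>b a. Wc b a * exp (\<theta> * f b a)) xs)
          - real n * (H * \<theta> + v * \<theta>\<^sup>2 / 2)\<bar> \<le> real n * (\<epsilon> * \<theta>\<^sup>2) + 8"
    have H: "Hc Wc = H" unfolding Hc_def ren by (rule tendsto_Lim[OF _ l1]) simp
    have v: "Vc Wc = v" unfolding Vc_def H ren by (rule tendsto_Lim[OF _ l2]) simp
    show ?thesis
    proof (rule that[of "path_sum f0 f"])
      fix xz assume pos: "markov_prob P Wc xz > 0"
      show "markov_prob (\<lambda>z. \<Sum>x\<in>UNIV. P (x, z)) (WcZ Wc) (map snd xz) = markov_prob P Wc xz * exp (path_sum f0 f xz)"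
        unfolding PZ_def[symmetric] snd_eq f0_def f_def
        by (rule markov_prob_change_of_measure[OF p0 W0 PZ WZ pos])
    qed (use mgf[OF _ pm, of _ f0] in \<open>simp add: H v markov_prob_tilt\<close>)
  qed
qed

text \<open>Both coding bounds compare \<open>P * Pc * N\<close> with \<open>Q\<close>, and on the
  support their quotient is exp A, with A the functional in the exponent. The choice \<gamma> = exp
  (- g) therefore turns the converse event into g \<le> A.\<close>

lemma Pj_bounds:
  fixes PM1 :: "'m::finite \<Rightarrow> real" and PXZ1 :: "('x::{finite,ab_group_add} \<times> 'z::finite) \<Rightarrow> real"
  assumes pm: "is_pmf PM1" "stochastic Ws" and pc: "is_pmf PXZ1" "stochastic Wc" and a1: "assumption1 Wc"
    and Fs: "\<And>ms. markov_prob PM1 Ws ms > 0 \<Longrightarrow> markov_prob PM1 Ws ms = exp (- Fs ms)"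
    and Fc: "\<And>xz. markov_prob PXZ1 Wc xz > 0 \<Longrightarrow>
       markov_prob (\<lambda>z. \<Sum>x\<in>UNIV. PXZ1 (x, z)) (WcZ Wc) (map snd xz) = markov_prob PXZ1 Wc xz * exp (Fc xz)"
  shows "0 \<le> \<theta> \<Longrightarrow> \<theta> \<le> 1 \<Longrightarrow> Pj PM1 Ws PXZ1 Wc k n \<le>
      (\<Sum>ms | length ms = k. \<Sum>xz | length xz = n. markov_prob PM1 Ws ms * markov_prob PXZ1 Wc xz *
          exp (\<theta> * (Fs ms + Fc xz - real n * ln (real CARD('x)))))"
    and "(\<Sum>ms | length ms = k. \<Sum>xz | length xz = n. markov_prob PM1 Ws ms * markov_prob PXZ1 Wc xz *
          of_bool (g \<le> Fs ms + Fc xz - real n * ln (real CARD('x)))) - exp (- g) \<le> Pj PM1 Ws PXZ1 Wc k n"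
proof -
  define P where "P = markov_prob PM1 Ws"
  define Pc where "Pc = markov_prob PXZ1 Wc"
  define Q where "Q = markov_prob (\<lambda>z. \<Sum>x\<in>UNIV. PXZ1 (x, z)) (WcZ Wc)"
  define N where "N = real CARD('x) ^ n"
  have N: "N > 0" "N = exp (real n * ln (real CARD('x)))" by (auto simp: N_def exp_of_nat_mult)
  have nn: "PM1 a \<ge> 0" "Ws a b \<ge> 0" "PXZ1 c \<ge> 0" "Wc c d \<ge> 0" for a b c d
    using pm pc unfolding is_pmf_def stochastic_def by blast+
  have P0: "P ms \<ge> 0" for ms
    unfolding P_def by (intro markov_prob_nonneg nn)
  have Pc0: "Pc ys \<ge> 0" for ys
    unfolding Pc_def by (intro markov_prob_nonneg nn)
  have Q0: "Q zs \<ge> 0" for zs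
    unfolding Q_def WcZ_def by (intro markov_prob_nonneg sum_nonneg nn)
  have P1: "(\<Sum>ms | length ms = k. P ms) = 1" unfolding P_def by (rule sum_markov_prob_eq_1[OF pm])
  have Pc1: "(\<Sum>xz | length xz = n. Pc xz) = 1" unfolding Pc_def by (rule sum_markov_prob_eq_1[OF pc])
  have Qm: "(\<Sum>xs | length xs = n. Pc (zip xs zs)) = Q zs" if "length zs = n" for zs
    unfolding Pc_def Q_def using sum_markov_prob_zip[OF a1, where zs = zs and P = PXZ1] that by simp
  have "(\<Sum>zs | length zs = n. Q zs) = (\<Sum>zs | length zs = n. \<Sum>xs | length xs = n. Pc (zip xs zs))"
    by (rule sum.cong[OF refl]) (simp add: Qm)
  hence Q1: "(\<Sum>zs | length zs = n. Q zs) = 1" using Pc1 unfolding sum_words_zip by simp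
  have err: "code_error PM1 Ws PXZ1 Wc k n e d =
      (\<Sum>ms | length ms = k. P ms * (\<Sum>ys | length ys = n \<and> d ys \<noteq> ms. Pc (shift ys (e ms))))" for e d
    by (simp add: code_error_def P_def Pc_def)
  define A where "A = (\<lambda>ms xz. Fs ms + Fc xz - real n * ln (real CARD('x)))"
  have ratio: "P ms * Pc xz * N * exp (A ms xz) = Q (map snd xz)" if "P ms * Pc xz \<noteq> 0" for ms xz
  proof -
    have pos: "P ms > 0" "Pc xz > 0" using that P0[of ms] Pc0[of xz] by (auto simp: order_less_le)
    have 1: "P ms * exp (Fs ms) = 1" using Fs[folded P_def, OF pos(1)] by (simp add: exp_minus)
    have 2: "Q (map snd xz) = Pc xz * exp (Fc xz)" using Fc[folded Pc_def Q_def, OF pos(2)] .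
    have 3: "N * exp (A ms xz) = exp (Fs ms) * exp (Fc xz)"
      unfolding N(2) A_def exp_add[symmetric] by simp
    have "P ms * Pc xz * N * exp (A ms xz) = (P ms * exp (Fs ms)) * (Pc xz * exp (Fc xz))"
      unfolding mult.assoc 3 by (simp add: mult_ac)
    thus ?thesis unfolding 1 2 by simp
  qed
  have bdd: "bdd_below {code_error PM1 Ws PXZ1 Wc k n e d | e d. \<forall>ms. length ms = k \<longrightarrow> length (e ms) = n}"
  proof (rule bdd_belowI[of _ 0])
    fix y assume "y \<in> {code_error PM1 Ws PXZ1 Wc k n e d | e d. \<forall>ms. length ms = k \<longrightarrow> length (e ms) = n}"
    then obtain e d where "y = code_error PM1 Ws PXZ1 Wc k n e d" by (elim CollectE exE conjE)
    thus "0 \<le> y" by (simp add: err sum_nonneg P0 Pc0)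
  qed
  {
    assume \<theta>: "0 \<le> \<theta>" "\<theta> \<le> 1"
    have "\<exists>e d. (\<forall>ms. length ms = k \<longrightarrow> length (e ms) = n) \<and>
      (\<Sum>ms | length ms = k. P ms * (\<Sum>ys | length ys = n \<and> d ys \<noteq> ms. Pc (shift ys (e ms)))) \<le>
      (\<Sum>ms | length ms = k. \<Sum>xz | length xz = n. P ms * Pc xz * min 1 (Q (map snd xz) / (P ms * Pc xz * N)))"
      by (rule random_coding_bound[OF P0 P1 Pc0 Qm, folded N_def])
    then obtain e d where ed: "\<forall>ms. length ms = k \<longrightarrow> length (e ms) = n"
      "(\<Sum>ms | length ms = k. P ms * (\<Sum>ys | length ys = n \<and> d ys \<noteq> ms. Pc (shift ys (e ms)))) \<le>
       (\<Sum>ms | length ms = k. \<Sum>xz | length xz = n. P ms * Pc xz * min 1 (Q (map snd xz) / (P ms * Pc xz * N)))"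
      by (elim exE conjE)
    have "Pj PM1 Ws PXZ1 Wc k n \<le> code_error PM1 Ws PXZ1 Wc k n e d"
      unfolding Pj_def by (rule cInf_lower[OF _ bdd], rule CollectI, rule exI[of _ e], rule exI[of _ d]) (use ed(1) in simp)
    also have "\<dots> \<le> (\<Sum>ms | length ms = k. \<Sum>xz | length xz = n. P ms * Pc xz * min 1 (Q (map snd xz) / (P ms * Pc xz * N)))"
      unfolding err by (rule ed(2))
    also have "\<dots> \<le> (\<Sum>ms | length ms = k. \<Sum>xz | length xz = n. P ms * Pc xz * exp (\<theta> * A ms xz))"
    proof (intro sum_mono)
      fix ms :: "'m list" and xz :: "('x \<times> 'z) list"
      show "P ms * Pc xz * min 1 (Q (map snd xz) / (P ms * Pc xz * N)) \<le> P ms * Pc xz * exp (\<theta> * A ms xz)"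
      proof (cases "P ms * Pc xz = 0")
        case False
        have "Q (map snd xz) / (P ms * Pc xz * N) = exp (A ms xz)"
          unfolding ratio[OF False, symmetric] using False N by simp
        moreover have "min 1 (exp (A ms xz)) \<le> exp (\<theta> * A ms xz)"
        proof (cases "A ms xz \<ge> 0")
          case True
          hence "0 \<le> \<theta> * A ms xz" using \<theta> by simp
          thus ?thesis by (simp add: min.coboundedI1)
        next
          case False
          hence "A ms xz \<le> \<theta> * A ms xz" using \<theta> mult_right_mono_neg[of \<theta> 1 "A ms xz"] by simp
          thus ?thesis by (simp add: min.coboundedI2)
        qed
        ultimately show ?thesis using P0 Pc0 by (intro mult_left_mono mult_nonneg_nonneg) auto
      qed (auto simp: P0 Pc0)
    qed
    finally show "Pj PM1 Ws PXZ1 Wc k n \<le>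
      (\<Sum>ms | length ms = k. \<Sum>xz | length xz = n. markov_prob PM1 Ws ms * markov_prob PXZ1 Wc xz *
          exp (\<theta> * (Fs ms + Fc xz - real n * ln (real CARD('x)))))" unfolding P_def Pc_def A_def .
  }
  have "(\<Sum>ms | length ms = k. \<Sum>xz | length xz = n. P ms * Pc xz * of_bool (g \<le> A ms xz)) - exp (- g) \<le> Pj PM1 Ws PXZ1 Wc k n"
    unfolding Pj_def
  proof (rule cInf_greatest)
    show "{code_error PM1 Ws PXZ1 Wc k n e d | e d. \<forall>ms. length ms = k \<longrightarrow> length (e ms) = n} \<noteq> {}"
      unfolding ex_in_conv[symmetric]
      \<comment> \<open>The witness encodes messages by \<open>replicate\<close> words; unification
        with \<open>length_replicate\<close> supplies it.\<close>
      by (rule exI, rule CollectI, rule exI, rule exI, rule conjI, rule refl)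
         (rule allI, rule impI, rule length_replicate)
  next
    fix y assume "y \<in> {code_error PM1 Ws PXZ1 Wc k n e d | e d. \<forall>ms. length ms = k \<longrightarrow> length (e ms) = n}"
    then obtain e d where y: "y = code_error PM1 Ws PXZ1 Wc k n e d" and "\<forall>ms. length ms = k \<longrightarrow> length (e ms) = n"
      by (elim CollectE exE conjE)
    hence len: "\<And>ms. length ms = k \<Longrightarrow> length (e ms) = n" by simp
    have "(\<Sum>ms | length ms = k. \<Sum>xz | length xz = n. P ms * Pc xz * of_bool (g \<le> A ms xz)) \<le>
        (\<Sum>ms | length ms = k. \<Sum>xz | length xz = n. P ms * Pc xz * of_bool (P ms * Pc xz * N \<le> exp (- g) * Q (map snd xz)))"
    proof (intro sum_mono)
      fix ms :: "'m list" and xz :: "('x \<times> 'z) list"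
      show "P ms * Pc xz * of_bool (g \<le> A ms xz) \<le> P ms * Pc xz * of_bool (P ms * Pc xz * N \<le> exp (- g) * Q (map snd xz))"
      proof (cases "P ms * Pc xz \<noteq> 0 \<and> g \<le> A ms xz")
        case True
        have "P ms * Pc xz * N * 1 \<le> P ms * Pc xz * N * (exp (- g) * exp (A ms xz))"
          using True P0 Pc0 N by (intro mult_left_mono mult_nonneg_nonneg) (auto simp flip: exp_add)
        also have "\<dots> = exp (- g) * Q (map snd xz)" using ratio[of ms xz] True by (simp add: mult_ac)
        finally show ?thesis using True by simp
      qed (use mult_nonneg_nonneg[OF P0[of ms] Pc0[of xz]] in auto)
    qed
    also have "\<dots> \<le> code_error PM1 Ws PXZ1 Wc k n e d + exp (- g)"
      unfolding err N_def by (rule error_lower_bound[OF P0 Pc0 Q0 Q1 exp_ge_zero len])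
    finally show "(\<Sum>ms | length ms = k. \<Sum>xz | length xz = n. P ms * Pc xz * of_bool (g \<le> A ms xz)) - exp (- g) \<le> y"
      unfolding y by linarith
  qed
  thus "(\<Sum>ms | length ms = k. \<Sum>xz | length xz = n. markov_prob PM1 Ws ms * markov_prob PXZ1 Wc xz *
          of_bool (g \<le> Fs ms + Fc xz - real n * ln (real CARD('x)))) - exp (- g) \<le> Pj PM1 Ws PXZ1 Wc k n"
    unfolding P_def Pc_def A_def .
qed

section \<open>Assembly of the moderate deviation limit\<close>

theorem mainTheorem17:
  fixes PM1 :: "'m::finite \<Rightarrow> real" and Ws :: "'m \<Rightarrow> 'm \<Rightarrow> real"
    and PXZ1 :: "('x::{finite,ab_group_add} \<times> 'z::finite) \<Rightarrow> real"
    and Wc :: "('x \<times> 'z) \<Rightarrow> ('x \<times> 'z) \<Rightarrow> real"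
    and t \<delta> :: real
  assumes "is_pmf PM1" and "stochastic Ws" and "irreducible_mc Ws" and "aperiodic_mc Ws"
    and "is_pmf PXZ1" and "stochastic Wc" and "irreducible_mc Wc" and "aperiodic_mc Wc"
    and "assumption1 Wc"
    and "Hs Ws > 0"
    and "ln (real CARD('x)) - Hc Wc > 0"
    and "(ln (real CARD('x)) - Hc Wc) / Hs Ws * Vs Ws + Vc Wc > 0"
    and "0 < t" and "t < 1/2" and "\<delta> > 0"
  shows "(\<lambda>n. - ln (Pj PM1 Ws PXZ1 Wc
                  (nat \<lfloor>real n * (ln (real CARD('x)) - Hc Wc) / Hs Ws - \<delta> * real n powr (1 - t)\<rfloor>) n)
              / real n powr (1 - 2 * t))
         \<longlonglongrightarrow> 1/2 * (\<delta>^2 / ((1 / (Hs Ws)^2) *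
               ((ln (real CARD('x)) - Hc Wc) / Hs Ws * Vs Ws + Vc Wc)))"
proof -
  define R where "R = ln (real CARD('x))"
  define C where "C = R - Hc Wc"
  define r where "r = C / Hs Ws"
  define V where "V = r * Vs Ws + Vc Wc"
  define \<kappa> where "\<kappa> = \<delta> * Hs Ws"
  define K where "K = \<kappa>\<^sup>2 / (2 * V)"
  define y where "y = (\<lambda>n. real n * C / Hs Ws - \<delta> * real n powr (1 - t))"
  define k where "k = (\<lambda>n. nat \<lfloor>y n\<rfloor>)"
  define s where "s = (\<lambda>n. real n powr (1 - 2 * t))"
  note t = assms(13,14)
  have H: "Hs Ws > 0" and C: "C > 0" and V: "V > 0" and \<delta>: "\<delta> > 0"
    using assms(10-12,15) by (auto simp: C_def R_def V_def r_def)
  have r: "r > 0" and \<kappa>: "\<kappa> > 0" using H C \<delta> by (auto simp: r_def \<kappa>_def)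
  have pos: "\<forall>\<^sub>F n in sequentially. n \<ge> (1::nat)" by (rule eventually_ge_at_top)
  have nt: "(\<lambda>n. real n powr - t) \<longlonglongrightarrow> 0"
    using t by (intro tendsto_neg_powr filterlim_real_sequentially) auto
  have nt1: "(\<lambda>n. real n powr (t - 1)) \<longlonglongrightarrow> 0"
    using t by (intro tendsto_neg_powr filterlim_real_sequentially) auto
  have s_top: "filterlim s at_top sequentially" unfolding s_def using t by real_asymp
  have powr1: "real n powr (1 - t) = real n * real n powr - t" if "n \<ge> 1" for n
    using that powr_add[of "real n" 1 "- t"] by simp
  have powr2: "s n = real n powr (1 - t) * real n powr - t" for n
    unfolding s_def powr_add[symmetric] by simp
  have powr3: "real n powr (1 - t) * real n powr (t - 1) = 1" if "n \<ge> 1" for n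
    using that unfolding powr_add[symmetric] by simp
  have "(\<lambda>n. r - \<delta> * real n powr - t) \<longlonglongrightarrow> r - \<delta> * 0" by (intro tendsto_intros nt)
  moreover have "\<forall>\<^sub>F n in sequentially. r - \<delta> * real n powr - t = y n / real n"
    using pos by eventually_elim (simp add: y_def r_def powr1 diff_divide_distrib)
  ultimately have "(\<lambda>n. y n / real n) \<longlonglongrightarrow> r - \<delta> * 0" by (rule Lim_transform_eventually)
  hence yr: "(\<lambda>n. y n / real n) \<longlonglongrightarrow> r" by simp
  have "filterlim (\<lambda>n. y n / real n * real n) at_top sequentially"
    by (rule filterlim_tendsto_pos_mult_at_top[OF yr r filterlim_real_sequentially])
  hence "\<forall>\<^sub>F n in sequentially. y n / real n * real n \<ge> 1" unfolding filterlim_at_top by blast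
  with pos have y1: "\<forall>\<^sub>F n in sequentially. y n \<ge> 1" by eventually_elim auto
  \<comment> \<open>\<open>nat\<close> truncates nothing because \<open>y n\<close> is eventually at
    least 1; the rounding error of at most 1 vanishes after division by n or n^(1-t).\<close>
  have ky: "\<forall>\<^sub>F n in sequentially. \<bar>real (k n) - y n\<bar> \<le> 1"
    using y1
  proof eventually_elim
    case (elim n)
    have "real (k n) = of_int \<lfloor>y n\<rfloor>" using elim by (simp add: k_def)
    thus ?case by linarith
  qed
  have k1: "\<forall>\<^sub>F n in sequentially. k n \<ge> 1"
    using y1
  proof eventually_elim
    case (elim n)
    hence "\<lfloor>y n\<rfloor> \<ge> 1" by linarith
    thus ?case unfolding k_def by linarith
  qed
  have kyt: "(\<lambda>n. (real (k n) - y n) * c n) \<longlonglongrightarrow> 0" if "c \<longlonglongrightarrow> 0" for c :: "nat \<Rightarrow> real"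
  proof (rule Lim_null_comparison)
    show "\<forall>\<^sub>F n in sequentially. norm ((real (k n) - y n) * c n) \<le> \<bar>c n\<bar>"
      using ky
    proof eventually_elim
      case (elim n)
      have "\<bar>real (k n) - y n\<bar> * \<bar>c n\<bar> \<le> 1 * \<bar>c n\<bar>" by (intro mult_right_mono elim) auto
      thus ?case by (simp add: abs_mult)
    qed
    show "(\<lambda>n. \<bar>c n\<bar>) \<longlonglongrightarrow> 0" using that by (rule tendsto_rabs_zero)
  qed
  have "(\<lambda>n. y n / real n + (real (k n) - y n) * (1 / real n)) \<longlonglongrightarrow> r + 0"
    by (intro tendsto_add yr kyt lim_1_over_n)
  hence kr: "(\<lambda>n. real (k n) / real n) \<longlonglongrightarrow> r" by (simp add: diff_divide_distrib)
  \<comment> \<open>These are the first-order terms of source, channel and n R together; the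
    exponent t - 1 comes from n^(-t) / n^(1-2t).\<close>
  have drift: "(\<lambda>n. a * ((real (k n) * Hs Ws - real n * C) * real n powr (t - 1))) \<longlonglongrightarrow> - \<kappa> * a" for a
  proof -
    have "(\<lambda>n. a * (Hs Ws * ((real (k n) - y n) * real n powr (t - 1)) - \<kappa>)) \<longlonglongrightarrow> a * (Hs Ws * 0 - \<kappa>)"
      by (intro tendsto_intros kyt nt1)
    moreover have "\<forall>\<^sub>F n in sequentially. a * (Hs Ws * ((real (k n) - y n) * real n powr (t - 1)) - \<kappa>) =
        a * ((real (k n) * Hs Ws - real n * C) * real n powr (t - 1))"
      using pos
    proof eventually_elim
      case (elim n)
      have "real (k n) * Hs Ws - real n * C = Hs Ws * (real (k n) - y n) - \<kappa> * real n powr (1 - t)"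
        using H by (simp add: y_def \<kappa>_def field_simps)
      hence "(real (k n) * Hs Ws - real n * C) * real n powr (t - 1) =
          Hs Ws * ((real (k n) - y n) * real n powr (t - 1)) - \<kappa> * (real n powr (1 - t) * real n powr (t - 1))"
        by (simp only: left_diff_distrib mult.assoc)
      thus ?case unfolding powr3[OF elim] by simp
    qed
    ultimately show ?thesis by (rule Lim_transform_eventually[THEN tendsto_eq_rhs]) simp
  qed

  obtain Fs where Fs: "\<And>ms. markov_prob PM1 Ws ms > 0 \<Longrightarrow> markov_prob PM1 Ws ms = exp (- Fs ms)"
    and mgfs: "\<And>\<epsilon>. \<epsilon> > 0 \<Longrightarrow> \<forall>\<^sub>F \<theta> in at 0. \<forall>n\<ge>1. (\<Sum>ms | length ms = n. markov_prob PM1 Ws ms * exp (\<theta> * Fs ms)) > 0 \<and>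
      \<bar>ln (\<Sum>ms | length ms = n. markov_prob PM1 Ws ms * exp (\<theta> * Fs ms)) - real n * (Hs Ws * \<theta> + Vs Ws * \<theta>\<^sup>2 / 2)\<bar>
        \<le> real n * (\<epsilon> * \<theta>\<^sup>2) + 8"
    using source_mgf[OF assms(1-3)] by blast
  obtain Fc where Fc: "\<And>xz. markov_prob PXZ1 Wc xz > 0 \<Longrightarrow>
       markov_prob (\<lambda>z. \<Sum>x\<in>UNIV. PXZ1 (x, z)) (WcZ Wc) (map snd xz) = markov_prob PXZ1 Wc xz * exp (Fc xz)"
    and mgfc: "\<And>\<epsilon>. \<epsilon> > 0 \<Longrightarrow> \<forall>\<^sub>F \<theta> in at 0. \<forall>n\<ge>1. (\<Sum>xz | length xz = n. markov_prob PXZ1 Wc xz * exp (\<theta> * Fc xz)) > 0 \<and>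
      \<bar>ln (\<Sum>xz | length xz = n. markov_prob PXZ1 Wc xz * exp (\<theta> * Fc xz)) - real n * (Hc Wc * \<theta> + Vc Wc * \<theta>\<^sup>2 / 2)\<bar>
        \<le> real n * (\<epsilon> * \<theta>\<^sup>2) + 8"
    using channel_mgf[OF assms(5-7,9)] by blast
  define Ss where "Ss = (\<lambda>n \<theta>. \<Sum>ms | length ms = n. markov_prob PM1 Ws ms * exp (\<theta> * Fs ms))"
  define Sc where "Sc = (\<lambda>n \<theta>. \<Sum>xz | length xz = n. markov_prob PXZ1 Wc xz * exp (\<theta> * Fc xz))"
  have n1: "(\<lambda>n. real n / real n) \<longlonglongrightarrow> 1"
    using tendsto_const by (rule Lim_transform_eventually) (use pos in \<open>eventually_elim, auto\<close>)
  have lims: "\<forall>\<^sub>F n in sequentially. Ss (k n) (a * real n powr - t) > 0"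
    "(\<lambda>n. (ln (Ss (k n) (a * real n powr - t)) - real (k n) * Hs Ws * (a * real n powr - t)) / real n powr (1 - 2 * t))
      \<longlonglongrightarrow> r * (a\<^sup>2 * Vs Ws / 2)" if a: "a > 0" for a
    by (rule moderate_scale_mgf_limit[where S = Ss and H = "Hs Ws" and v = "Vs Ws" and k = "k", OF _ k1 kr t a],
        (use mgfs in \<open>simp add: Ss_def\<close>))+
  have limc: "\<forall>\<^sub>F n in sequentially. Sc n (a * real n powr - t) > 0"
    "(\<lambda>n. (ln (Sc n (a * real n powr - t)) - real n * Hc Wc * (a * real n powr - t)) / real n powr (1 - 2 * t))
      \<longlonglongrightarrow> 1 * (a\<^sup>2 * Vc Wc / 2)" if a: "a > 0" for a
    by (rule moderate_scale_mgf_limit[where S = Sc and H = "Hc Wc" and v = "Vc Wc" and k = "\<lambda>n. n", OF _ pos n1 t a],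
        (use mgfc in \<open>simp add: Sc_def\<close>))+

  define \<Omega> where "\<Omega> = (\<lambda>n. {ms :: 'm list. length ms = k n} \<times> {xz :: ('x \<times> 'z) list. length xz = n})"
  define w where "w = (\<lambda>(n::nat) (ms, xz). markov_prob PM1 Ws ms * markov_prob PXZ1 Wc xz)"
  define A where "A = (\<lambda>n (ms, xz). Fs ms + Fc xz - real n * R)"
  \<comment> \<open>Normalised so that s X = n^(-t) A: a tilt of \<open>X\<close> by
    \<open>a\<close> at speed \<open>s\<close> is the tilt a n^(-t) of \<open>A\<close>.\<close>
  define X where "X = (\<lambda>n i. A n i / real n powr (1 - t))"
  define M where "M = (\<lambda>n a. \<Sum>i\<in>\<Omega> n. w n i * exp (a * (s n * X n i)))"
  have sX: "s n * X n i = real n powr - t * A n i" if "n \<ge> 1" for n i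
    using that by (simp add: X_def powr2)
  have M_A: "M n a = (\<Sum>i\<in>\<Omega> n. w n i * exp (a * real n powr - t * A n i))" if "n \<ge> 1" for n a
    unfolding M_def by (simp add: sX[OF that] mult.assoc)
  \<comment> \<open>Message and noise are independent, so the sum over pairs factors.\<close>
  have M_eq: "M n a = Ss (k n) (a * real n powr - t) * Sc n (a * real n powr - t) * exp (- (real n * R * (a * real n powr - t)))"
    if n: "n \<ge> 1" for n a
  proof -
    have e: "exp (\<theta> * (b + c - d)) = exp (\<theta> * b) * exp (\<theta> * c) * exp (- (d * \<theta>))" for b c d \<theta> :: real
      unfolding exp_add[symmetric] by (simp add: algebra_simps)
    have "(\<Sum>i\<in>\<Omega> n. w n i * exp (a * real n powr - t * A n i)) =
        (\<Sum>ms | length ms = k n. \<Sum>xz | length xz = n. (markov_prob PM1 Ws ms * exp (a * real n powr - t * Fs ms)) *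
          (markov_prob PXZ1 Wc xz * exp (a * real n powr - t * Fc xz)) * exp (- (real n * R * (a * real n powr - t))))"
      unfolding \<Omega>_def sum.cartesian_product by (intro sum.cong refl) (auto simp: w_def A_def e)
    thus ?thesis unfolding M_A[OF n] Ss_def Sc_def sum_product by (simp only: sum_distrib_right)
  qed
  have w0: "w n i \<ge> 0" for n i
    using assms(1,2,5,6) by (cases i)
      (auto simp: w_def is_pmf_def stochastic_def intro!: mult_nonneg_nonneg markov_prob_nonneg)
  have M0: "\<forall>\<^sub>F n in sequentially. M n a > 0" if "a > 0" for a
    using lims(1)[OF that] limc(1)[OF that] pos by eventually_elim (simp add: M_eq)
  have limM: "(\<lambda>n. ln (M n a) / s n) \<longlonglongrightarrow> a\<^sup>2 * V / 2 - \<kappa> * a" if a: "a > 0" for a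
  proof -
    let ?\<theta> = "\<lambda>n. a * real n powr - t"
    have "(\<lambda>n. (ln (Ss (k n) (?\<theta> n)) - real (k n) * Hs Ws * ?\<theta> n) / s n + (ln (Sc n (?\<theta> n)) - real n * Hc Wc * ?\<theta> n) / s n
        + a * ((real (k n) * Hs Ws - real n * C) * real n powr (t - 1))) \<longlonglongrightarrow>
        r * (a\<^sup>2 * Vs Ws / 2) + 1 * (a\<^sup>2 * Vc Wc / 2) + - \<kappa> * a"
      unfolding s_def by (intro tendsto_add lims(2)[OF a] limc(2)[OF a] drift)
    moreover have "\<forall>\<^sub>F n in sequentially. (ln (Ss (k n) (?\<theta> n)) - real (k n) * Hs Ws * ?\<theta> n) / s n + (ln (Sc n (?\<theta> n)) - real n * Hc Wc * ?\<theta> n) / s n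
        + a * ((real (k n) * Hs Ws - real n * C) * real n powr (t - 1)) = ln (M n a) / s n"
      using lims(1)[OF a] limc(1)[OF a] pos
    proof eventually_elim
      case (elim n)
      have sn: "s n > 0" using elim(3) by (simp add: s_def)
      have "s n * real n powr (t - 1) = real n powr - t"
        using powr3[OF elim(3)] by (simp add: powr2 mult_ac)
      hence e: "real n powr (t - 1) = real n powr - t / s n" using sn by (simp add: field_simps)
      have L: "ln (M n a) = ln (Ss (k n) (?\<theta> n)) + ln (Sc n (?\<theta> n)) - real n * R * ?\<theta> n"
        using elim by (simp add: M_eq ln_mult)
      show ?case unfolding e L by (simp add: C_def diff_divide_distrib add_divide_distrib algebra_simps)
    qed
    ultimately show ?thesis
      by (rule Lim_transform_eventually[THEN tendsto_eq_rhs]) (simp add: V_def algebra_simps add_divide_distrib)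
  qed

  define p where "p = (\<lambda>n. Pj PM1 Ws PXZ1 Wc (k n) n)"
  have sum_\<Omega>: "(\<Sum>ms | length ms = k n. \<Sum>xz | length xz = n. markov_prob PM1 Ws ms * markov_prob PXZ1 Wc xz *
          G (Fs ms + Fc xz - real n * ln (real CARD('x)))) = (\<Sum>i\<in>\<Omega> n. w n i * G (A n i))" for n and G :: "real \<Rightarrow> real"
    unfolding sum.cartesian_product \<Omega>_def by (intro sum.cong refl) (auto simp: w_def A_def R_def)
  have Pj_upper: "p n \<le> (\<Sum>i\<in>\<Omega> n. w n i * exp (\<theta> * A n i))" if "0 \<le> \<theta>" "\<theta> \<le> 1" for n \<theta>
    unfolding p_def sum_\<Omega>[where n = n and G = "\<lambda>x. exp (\<theta> * x)", symmetric]
    by (rule Pj_bounds(1)[OF assms(1,2,5,6,9)]) (fact Fs, fact Fc, fact+)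
  have Pj_lower: "(\<Sum>i\<in>\<Omega> n. w n i * of_bool (g \<le> A n i)) - exp (- g) \<le> p n" for n g
    unfolding p_def sum_\<Omega>[where n = n and G = "\<lambda>x. of_bool (g \<le> x)", symmetric]
    by (rule Pj_bounds(2)[OF assms(1,2,5,6,9)]) (fact Fs, fact Fc)
  have upper: "\<forall>\<^sub>F n in sequentially. p n \<le> M n (\<kappa> / V)"
  proof -
    \<comment> \<open>\<kappa> / V minimises a^2 V / 2 - \<kappa> a; the resulting tilt must be at
      most 1 for \<open>Pj_upper\<close>, which holds for large n.\<close>
    have "(\<lambda>n. \<kappa> / V * real n powr - t) \<longlonglongrightarrow> \<kappa> / V * 0" by (intro tendsto_intros nt)
    hence "\<forall>\<^sub>F n in sequentially. \<kappa> / V * real n powr - t < 1" by (rule order_tendstoD) simp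
    thus ?thesis using pos
    proof eventually_elim
      case (elim n)
      have "0 \<le> \<kappa> / V * real n powr - t" using \<kappa> V by simp
      thus ?case unfolding M_A[OF elim(2)] using elim(1) by (intro Pj_upper) auto
    qed
  qed
  have lower: "\<forall>\<^sub>F n in sequentially. p n \<ge> exp (- s n * (K + \<epsilon>))" if \<epsilon>: "\<epsilon> > 0" for \<epsilon>
  proof -
    \<comment> \<open>Chosen so that the loss 3\<eta>(\<kappa> + 2\<eta>)/V of
      \<open>quadratic_mgf_lower_tail\<close> is at most \<epsilon>/2; the cap 1 gives \<kappa> +
      2\<eta> \<le> \<kappa> + 2.\<close>
    define \<eta> where "\<eta> = min 1 (\<epsilon> * V / (6 * (\<kappa> + 2)))"
    have \<eta>: "\<eta> > 0" "\<eta> \<le> 1" "\<eta> \<le> \<epsilon> * V / (6 * (\<kappa> + 2))" using \<epsilon> V \<kappa> by (auto simp: \<eta>_def)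
    have "3 * \<eta> * (\<kappa> + 2 * \<eta>) \<le> 3 * \<eta> * (\<kappa> + 2)" using \<eta> by simp
    also have "\<dots> \<le> \<epsilon> / 2 * V" using \<eta>(3) \<kappa> by (simp add: pos_le_divide_eq algebra_simps)
    finally have \<eta>2: "3 * \<eta> * (\<kappa> + 2 * \<eta>) / V \<le> \<epsilon> / 2" using V by (simp add: pos_divide_le_eq)
    have tail: "\<forall>\<^sub>F n in sequentially. exp (- s n * (\<kappa>\<^sup>2 / (2 * V) + 3 * \<eta> * (\<kappa> + 2 * \<eta>) / V)) \<le>
           (\<Sum>i\<in>\<Omega> n. w n i * of_bool (\<eta> \<le> X n i))"
      by (rule quadratic_mgf_lower_tail[OF w0 s_top V \<kappa> \<eta>(1)]) (use M0 limM in \<open>simp_all add: M_def\<close>)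
    have "(\<lambda>n. (K + \<epsilon>) * real n powr - t) \<longlonglongrightarrow> (K + \<epsilon>) * 0" by (intro tendsto_intros nt)
    hence small: "\<forall>\<^sub>F n in sequentially. (K + \<epsilon>) * real n powr - t < \<eta>" by (rule order_tendstoD) (use \<eta> in simp)
    \<comment> \<open>Gives exp (s \<epsilon> / 2) \<ge> 2, so the loss exp (- s (K + \<epsilon>))
      in the converse is at most half of the tail bound exp (- s (K + \<epsilon>/2)).\<close>
    have large: "\<forall>\<^sub>F n in sequentially. s n \<ge> 2 / \<epsilon>" using s_top unfolding filterlim_at_top by blast
    show ?thesis using tail small large pos
    proof eventually_elim
      case (elim n)
      have sn: "s n > 0" using elim(4) by (simp add: s_def)
      \<comment> \<open>The converse is used with g = s (K + \<epsilon>), which is o(n^(1-t)); so X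
        \<ge> \<eta> eventually forces A \<ge> g.\<close>
      have imp: "s n * (K + \<epsilon>) \<le> A n i" if "\<eta> \<le> X n i" for i
      proof -
        have "s n * (K + \<epsilon>) = real n powr (1 - t) * ((K + \<epsilon>) * real n powr - t)" by (simp add: powr2 mult_ac)
        also have "\<dots> \<le> real n powr (1 - t) * X n i" using elim(2) that by (intro mult_left_mono) auto
        also have "\<dots> = A n i" using elim(4) by (simp add: X_def)
        finally show ?thesis .
      qed
      have "exp (- s n * (K + \<epsilon> / 2)) \<le> exp (- s n * (\<kappa>\<^sup>2 / (2 * V) + 3 * \<eta> * (\<kappa> + 2 * \<eta>) / V))"
        using sn \<eta>2 unfolding K_def by (simp add: mult_left_mono)
      also note elim(1)
      also have "(\<Sum>i\<in>\<Omega> n. w n i * of_bool (\<eta> \<le> X n i)) \<le> (\<Sum>i\<in>\<Omega> n. w n i * of_bool (s n * (K + \<epsilon>) \<le> A n i))"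
        by (intro sum_mono mult_left_mono w0) (auto dest: imp)
      also have "\<dots> \<le> p n + exp (- (s n * (K + \<epsilon>)))"
        using Pj_lower[of n "s n * (K + \<epsilon>)"] by simp
      finally have 1: "exp (- s n * (K + \<epsilon> / 2)) \<le> p n + exp (- (s n * (K + \<epsilon>)))" .
      have "2 * exp (- (s n * (K + \<epsilon>))) \<le> exp (s n * (\<epsilon> / 2)) * exp (- (s n * (K + \<epsilon>)))"
      proof (rule mult_right_mono)
        have "1 \<le> s n * (\<epsilon> / 2)" using elim(3) \<epsilon> by (simp add: pos_divide_le_eq)
        thus "2 \<le> exp (s n * (\<epsilon> / 2))" using exp_ge_add_one_self[of "s n * (\<epsilon> / 2)"] by linarith
      qed simp
      also have "\<dots> = exp (- s n * (K + \<epsilon> / 2))" unfolding exp_add[symmetric] by (simp add: algebra_simps)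
      finally show ?case using 1 by simp
    qed
  qed
  have "(\<lambda>n. - ln (p n) / s n) \<longlonglongrightarrow> K"
  proof (rule tendstoI)
    fix e :: real assume e: "e > 0"
    hence e2: "e / 2 > 0" by simp
    have kV: "\<kappa> / V > 0" using \<kappa> V by simp
    have "(\<kappa> / V)\<^sup>2 * V / 2 - \<kappa> * (\<kappa> / V) = - K" using V by (simp add: K_def field_simps power2_eq_square)
    hence "(\<lambda>n. ln (M n (\<kappa> / V)) / s n) \<longlonglongrightarrow> - K" using limM[OF kV] by simp
    hence "\<forall>\<^sub>F n in sequentially. ln (M n (\<kappa> / V)) / s n < - K + e" by (rule order_tendstoD) (use e in simp)
    thus "\<forall>\<^sub>F n in sequentially. dist (- ln (p n) / s n) K < e"
      using upper lower[OF e2] pos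
    proof eventually_elim
      case (elim n)
      have sn: "s n > 0" using elim(4) by (simp add: s_def)
      have p0: "p n > 0" using elim(3) by (rule less_le_trans[OF exp_gt_zero])
      have "ln (p n) \<le> ln (M n (\<kappa> / V))" using p0 elim(2) by (subst ln_le_cancel_iff) auto
      hence "ln (p n) / s n \<le> ln (M n (\<kappa> / V)) / s n" using sn by (intro divide_right_mono) auto
      hence 1: "ln (p n) / s n < - K + e" using elim(1) by linarith
      have "- s n * (K + e / 2) \<le> ln (p n)" using elim(3) p0 by (simp add: ln_ge_iff)
      hence "- (K + e / 2) * s n \<le> ln (p n)" by (simp add: algebra_simps)
      hence "- (K + e / 2) \<le> ln (p n) / s n" using sn by (subst pos_le_divide_eq)
      thus ?case using 1 e unfolding dist_real_def minus_divide_left[symmetric] abs_less_iff by linarith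
    qed
  qed
  moreover have "K = 1/2 * (\<delta>^2 / ((1 / (Hs Ws)^2) * ((ln (real CARD('x)) - Hc Wc) / Hs Ws * Vs Ws + Vc Wc)))"
    unfolding K_def V_def r_def C_def R_def \<kappa>_def using H by (simp add: power_mult_distrib)
  ultimately show ?thesis unfolding p_def k_def y_def s_def C_def R_def by simp
qed

end
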